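(* Let $G=(V,w,\mu,d)$ be a finite connected weighted graph equipped with a general path distance $d$, and let $m\ge1$. Then $G$ is Ollivier-Betti sharp with $\beta_1(M_2(G))=m$ if and only if there exist an abelian group structure $\cdot$ on $V$ and elements $a_1,\dots,a_m\in V$ such that $((V,\cdot),(a_1,\dots,a_m),w,\mu,d)$ is a weighted flat torus.
   Context: Graph setting: $V$ finite, $w:V\times V\to[0,\infty)$ symmetric vanishing on the diagonal, $\mu:V\to(0,\infty)$, $x\sim y$ iff $w(x,y)>0$, $G$ connected; $d$ is a general path distance: symmetric, $d(x,y)=0$ iff $x=y$, and $d(x,y)=\inf\{\sum_{k=1}^n d(x_{k-1},x_k): x=x_0\sim\dots\sim x_n=y\}$. $\deg(x)=|\{y:y\sim x\}|$, $\deg_{\max}=\max_x\deg(x)$. Laplacian $\Delta f(x)=\sum_y\frac{w(x,y)}{\mu(x)}(f(y)-f(x))$; $\nabla_{xy}f=\frac{f(x)-f(y)}{d(x,y)}$, $\|\nabla f\|_\infty=\sup_{x\ne y}|\nabla_{xy}f|$; Ollivier curvature $\kappa(x,y)=\inf\{\nabla_{xy}\Delta f:\nabla_{yx}f=1,\|\nabla f\|_\infty=1\}$; non-negative Ollivier curvature means $\kappa(x,y)\ge0$ for all $x\sim y$. $M_2(G)$: 1-forms are antisymmetric functions $\alpha(x,y)=-\alpha(y,x)$ on ordered adjacent pairs. A cycle is $(x_0\sim\dots\sim x_{n-1})$, distinct vertices, $n\ge3$, $x_{n-1}\sim x_0$, up to rotation and reversal. $X_2$ = cycles admitting a labeling with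 $n=3$, or with $d(x_0,x_3)<d(x_0,x_1)+d(x_1,x_2)+d(x_2,x_3)$ and $x_3\sim\dots\sim x_{n-1}\sim x_0$ a geodesic. $\delta\alpha(c)=\sum_i\alpha(x_i,x_{i+1\bmod n})$, $\delta^*\alpha(x)=\sum_y\frac{w(x,y)}{\mu(x)}\alpha(x,y)$, $H_1(M_2(G))=\{\alpha:\delta\alpha=0\text{ on }X_2,\ \delta^*\alpha\equiv0\}$, $\beta_1(M_2(G))=\dim H_1(M_2(G))$. $G$ is Ollivier-Betti sharp if it has non-negative Ollivier curvature and $\beta_1(M_2(G))=\deg_{\max}/2$. $T=((V,\cdot),(a_1,\dots,a_m),w,\mu,d)$ is a weighted flat torus if $(V,\cdot)$ is an abelian group generated by $\{a_1,\dots,a_m\}$ with $a_i\ne a_j^{\varepsilon}$ for all $i\ne j$, $\varepsilon\in\{-1,1\}$, $d$ is a general path distance, and, with $p(x,y)=w(x,y)/\mu(x)$: (i) $w(x,y)>0$ iff $y\in\{a_i^{\varepsilon}\cdot x: 1\le i\le m,\ \varepsilon=\pm1\}$; (ii) $w(x,a_i x)d(x,a_i x)=w(x,a_i^{-1}x)d(x,a_i^{-1}x)$ for all $x,i$; (iii) $p(x,a_i^{\varepsilon_1}x)=p(a_j^{\varepsilon_2}x,a_i^{\varepsilon_1}a_j^{\varepsilon_2}x)$ for all $x$, $i\ne j$, $\varepsilon_1,\varepsilon_2\in\{\pm1\}$; (iv) $d(x,a_i x)=d(a_j x,a_i a_j x)$ for all $x$ and $i\ne j$; (v) $\beta_1(M_2(T))=m$.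 *)

theory Defs
  imports "HOL-Analysis.Analysis" "HOL-Algebra.Generated_Groups"
begin

text \<open>
  The vertex set is the universe of a finite type \<open>'v\<close>. A weighted graph is given by the edge
  weights \<open>w\<close> and the vertex measure \<open>\<mu>\<close>.
\<close>

definition adj :: "('v \<Rightarrow> 'v \<Rightarrow> real) \<Rightarrow> 'v \<Rightarrow> 'v \<Rightarrow> bool" where
  "adj w x y \<longleftrightarrow> w x y > 0"

definition connected_weighted_graph ::
  "('v::finite \<Rightarrow> 'v \<Rightarrow> real) \<Rightarrow> ('v \<Rightarrow> real) \<Rightarrow> bool" where
  "connected_weighted_graph w \<mu> \<longleftrightarrow>
     (\<forall>x y. 0 \<le> w x y) \<and> (\<forall>x y. w x y = w y x) \<and> (\<forall>x. w x x = 0) \<and>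
     (\<forall>x. 0 < \<mu> x) \<and> (\<forall>x y. (adj w)\<^sup>*\<^sup>* x y)"

definition walk_betw :: "('v \<Rightarrow> 'v \<Rightarrow> real) \<Rightarrow> 'v \<Rightarrow> 'v list \<Rightarrow> 'v \<Rightarrow> bool" where
  "walk_betw w x p y \<longleftrightarrow>
     p \<noteq> [] \<and> hd p = x \<and> last p = y \<and> (\<forall>k. Suc k < length p \<longrightarrow> adj w (p ! k) (p ! Suc k))"

definition walk_length :: "('v \<Rightarrow> 'v \<Rightarrow> real) \<Rightarrow> 'v list \<Rightarrow> real" where
  "walk_length d p = (\<Sum>k<length p - 1. d (p ! k) (p ! Suc k))"

text \<open>The one-vertex walk is admitted; this is what makes the infimum vanish for \<open>x = y\<close>.\<close>

definition general_path_distance ::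
  "('v::finite \<Rightarrow> 'v \<Rightarrow> real) \<Rightarrow> ('v \<Rightarrow> 'v \<Rightarrow> real) \<Rightarrow> bool" where
  "general_path_distance w d \<longleftrightarrow>
     (\<forall>x y. 0 \<le> d x y) \<and> (\<forall>x y. d x y = d y x) \<and> (\<forall>x y. d x y = 0 \<longleftrightarrow> x = y) \<and>
     (\<forall>x y. d x y = Inf {walk_length d p | p. walk_betw w x p y})"

definition vertex_degree :: "('v::finite \<Rightarrow> 'v \<Rightarrow> real) \<Rightarrow> 'v \<Rightarrow> nat" where
  "vertex_degree w x = card {y. adj w y x}"

definition max_degree :: "('v::finite \<Rightarrow> 'v \<Rightarrow> real) \<Rightarrow> nat" where
  "max_degree w = Max (range (vertex_degree w))"

definition laplacian ::
  "('v::finite \<Rightarrow> 'v \<Rightarrow> real) \<Rightarrow> ('v \<Rightarrow> real) \<Rightarrow> ('v \<Rightarrow> real) \<Rightarrow> 'v \<Rightarrow> real" where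
  "laplacian w \<mu> f x = (\<Sum>y\<in>UNIV. w x y / \<mu> x * (f y - f x))"

definition grad :: "('v \<Rightarrow> 'v \<Rightarrow> real) \<Rightarrow> 'v \<Rightarrow> 'v \<Rightarrow> ('v \<Rightarrow> real) \<Rightarrow> real" where
  "grad d x y f = (f x - f y) / d x y"

definition grad_norm :: "('v::finite \<Rightarrow> 'v \<Rightarrow> real) \<Rightarrow> ('v \<Rightarrow> real) \<Rightarrow> real" where
  "grad_norm d f = Sup {\<bar>grad d x y f\<bar> | x y. x \<noteq> y}"

text \<open>
  For \<open>x \<noteq> y\<close> the set below is nonempty (take \<open>f = d x\<close>) and bounded below
  (\<open>f\<close> is 1-Lipschitz on a finite space), so the real-valued infimum is the true one.
\<close>

definition ollivier_curvature ::
  "('v::finite \<Rightarrow> 'v \<Rightarrow> real) \<Rightarrow> ('v \<Rightarrow> real) \<Rightarrow> ('v \<Rightarrow> 'v \<Rightarrow> real) \<Rightarrow> 'v \<Rightarrow> 'v \<Rightarrow> real" where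
  "ollivier_curvature w \<mu> d x y =
     Inf {grad d x y (laplacian w \<mu> f) | f. grad d y x f = 1 \<and> grad_norm d f = 1}"

definition nonneg_ollivier_curvature ::
  "('v::finite \<Rightarrow> 'v \<Rightarrow> real) \<Rightarrow> ('v \<Rightarrow> real) \<Rightarrow> ('v \<Rightarrow> 'v \<Rightarrow> real) \<Rightarrow> bool" where
  "nonneg_ollivier_curvature w \<mu> d \<longleftrightarrow>
     (\<forall>x y. adj w x y \<longrightarrow> ollivier_curvature w \<mu> d x y \<ge> 0)"

text \<open>
  Cycles are represented by their labelings \<open>[x\<^sub>0, \<dots>, x\<^bsub>n-1\<^esub>]\<close>; two labelings denote the same
  cycle iff they are related by \<open>same_cycle\<close>. The set \<open>X2\<close> consists of all labelings of the
  cycles in question. Relabeling changes \<open>coboundary \<alpha>\<close> at most by a sign.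
\<close>

definition is_cycle :: "('v \<Rightarrow> 'v \<Rightarrow> real) \<Rightarrow> 'v list \<Rightarrow> bool" where
  "is_cycle w c \<longleftrightarrow>
     length c \<ge> 3 \<and> distinct c \<and> (\<forall>i<length c. adj w (c ! i) (c ! (Suc i mod length c)))"

definition same_cycle :: "'v list \<Rightarrow> 'v list \<Rightarrow> bool" where
  "same_cycle c c' \<longleftrightarrow> (\<exists>k. c' = rotate k c \<or> c' = rotate k (rev c))"

definition geodesic :: "('v \<Rightarrow> 'v \<Rightarrow> real) \<Rightarrow> ('v \<Rightarrow> 'v \<Rightarrow> real) \<Rightarrow> 'v list \<Rightarrow> bool" where
  "geodesic w d p \<longleftrightarrow>
     walk_betw w (hd p) p (last p) \<and> walk_length d p = d (hd p) (last p)"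

definition X2 :: "('v \<Rightarrow> 'v \<Rightarrow> real) \<Rightarrow> ('v \<Rightarrow> 'v \<Rightarrow> real) \<Rightarrow> 'v list set" where
  "X2 w d = {c. is_cycle w c \<and>
     (\<exists>x. same_cycle c x \<and>
        (length x = 3 \<or>
         length x \<ge> 4 \<and>
         d (x ! 0) (x ! 3) < d (x ! 0) (x ! 1) + d (x ! 1) (x ! 2) + d (x ! 2) (x ! 3) \<and>
         geodesic w d (drop 3 x @ [x ! 0])))}"

text \<open>
  A 1-form lives on the ordered adjacent pairs; it is extended by \<open>0\<close> to all pairs, so that
  1-forms make up a subspace of \<open>real^'v^'v\<close>, with \<open>\<alpha> $ x $ y\<close> the value at \<open>(x, y)\<close>.
\<close>

definition one_forms :: "('v::finite \<Rightarrow> 'v \<Rightarrow> real) \<Rightarrow> (real^'v^'v) set" where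
  "one_forms w =
     {\<alpha>. (\<forall>x y. adj w x y \<longrightarrow> \<alpha> $ x $ y = - \<alpha> $ y $ x) \<and> (\<forall>x y. \<not> adj w x y \<longrightarrow> \<alpha> $ x $ y = 0)}"

definition coboundary :: "real^'v^'v \<Rightarrow> 'v::finite list \<Rightarrow> real" where
  "coboundary \<alpha> c = (\<Sum>i<length c. \<alpha> $ (c ! i) $ (c ! (Suc i mod length c)))"

definition coboundary_adjoint ::
  "('v::finite \<Rightarrow> 'v \<Rightarrow> real) \<Rightarrow> ('v \<Rightarrow> real) \<Rightarrow> real^'v^'v \<Rightarrow> 'v \<Rightarrow> real" where
  "coboundary_adjoint w \<mu> \<alpha> x = (\<Sum>y\<in>UNIV. w x y / \<mu> x * \<alpha> $ x $ y)"

definition H1 ::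
  "('v::finite \<Rightarrow> 'v \<Rightarrow> real) \<Rightarrow> ('v \<Rightarrow> real) \<Rightarrow> ('v \<Rightarrow> 'v \<Rightarrow> real) \<Rightarrow> (real^'v^'v) set" where
  "H1 w \<mu> d = {\<alpha> \<in> one_forms w.
     (\<forall>c \<in> X2 w d. coboundary \<alpha> c = 0) \<and> (\<forall>x. coboundary_adjoint w \<mu> \<alpha> x = 0)}"

definition betti1 ::
  "('v::finite \<Rightarrow> 'v \<Rightarrow> real) \<Rightarrow> ('v \<Rightarrow> real) \<Rightarrow> ('v \<Rightarrow> 'v \<Rightarrow> real) \<Rightarrow> nat" where
  "betti1 w \<mu> d = dim (H1 w \<mu> d)"

definition ollivier_betti_sharp ::
  "('v::finite \<Rightarrow> 'v \<Rightarrow> real) \<Rightarrow> ('v \<Rightarrow> real) \<Rightarrow> ('v \<Rightarrow> 'v \<Rightarrow> real) \<Rightarrow> bool" where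
  "ollivier_betti_sharp w \<mu> d \<longleftrightarrow>
     nonneg_ollivier_curvature w \<mu> d \<and> real (betti1 w \<mu> d) = real (max_degree w) / 2"

text \<open>The generators are \<open>a 1, \<dots>, a m\<close>; other values of \<open>a\<close> are irrelevant.\<close>

definition weighted_flat_torus ::
  "'v::finite monoid \<Rightarrow> nat \<Rightarrow> (nat \<Rightarrow> 'v) \<Rightarrow> ('v \<Rightarrow> 'v \<Rightarrow> real) \<Rightarrow> ('v \<Rightarrow> real) \<Rightarrow>
   ('v \<Rightarrow> 'v \<Rightarrow> real) \<Rightarrow> bool" where
  "weighted_flat_torus A m a w \<mu> d \<longleftrightarrow>
     (let p = (\<lambda>x y. w x y / \<mu> x);
          act = (\<lambda>i (\<epsilon>::int) x. (a i [^]\<^bsub>A\<^esub> \<epsilon>) \<otimes>\<^bsub>A\<^esub> x)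
      in comm_group A \<and> carrier A = UNIV \<and> generate A (a ` {1..m}) = UNIV \<and>
         (\<forall>i\<in>{1..m}. \<forall>j\<in>{1..m}. \<forall>\<epsilon>\<in>{-1, 1::int}. i \<noteq> j \<longrightarrow> a i \<noteq> a j [^]\<^bsub>A\<^esub> \<epsilon>) \<and>
         general_path_distance w d \<and>
         (\<forall>x y. w x y > 0 \<longleftrightarrow> (\<exists>i\<in>{1..m}. \<exists>\<epsilon>\<in>{-1, 1}. y = act i \<epsilon> x)) \<and>
         (\<forall>x. \<forall>i\<in>{1..m}.
            w x (act i 1 x) * d x (act i 1 x) = w x (act i (-1) x) * d x (act i (-1) x)) \<and>
         (\<forall>x. \<forall>i\<in>{1..m}. \<forall>j\<in>{1..m}. \<forall>\<epsilon>1\<in>{-1, 1}. \<forall>\<epsilon>2\<in>{-1, 1}. i \<noteq> j \<longrightarrow>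
            p x (act i \<epsilon>1 x) = p (act j \<epsilon>2 x) (act i \<epsilon>1 (act j \<epsilon>2 x))) \<and>
         (\<forall>x. \<forall>i\<in>{1..m}. \<forall>j\<in>{1..m}. i \<noteq> j \<longrightarrow>
            d x (act i 1 x) = d (act j 1 x) (act i 1 (act j 1 x))) \<and>
         betti1 w \<mu> d = m)"

end

theory Submission
  imports Defs
begin

text \<open>
  Let \<open>\<alpha>\<close> be a harmonic form with \<open>|\<alpha>| \<le> s d\<close> and call an edge tight if \<open>\<alpha>(x,y) = s d(x,y)\<close>.
  Since \<open>\<alpha>\<close> is closed on \<open>X2\<close>, around every edge it is the differential of a Lipschitz function,
  so the curvature bound controls \<open>\<delta>\<^sup>*\<close> along tight edges, for \<open>\<alpha>\<close> and for small perturbations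
  \<open>\<alpha> - \<epsilon> dh\<close>. Consequently \<open>\<Delta>h\<close> is constant on the strongly connected components of the tight
  edges whenever \<open>h\<close> is monotone along them. This forces every vertex onto a tight cycle:
  a vertex off the tight cycles but adjacent to one would be adjacent to all of that cycle, and the
  resulting triangles would make \<open>\<alpha>\<close> strictly increase around it; and without any tight cycle the
  sup norm of \<open>\<alpha>\<close> could be lowered within its cohomology class, against harmonicity.

  So for every \<open>x\<close> the functionals \<open>\<alpha> \<mapsto> \<alpha>(x,y)/d(x,y)\<close>, \<open>y \<sim> x\<close>, have as convex hull the unit
  ball dual to the sup norm on harmonic forms. This ball is symmetric and does not depend on \<open>x\<close>; having at least
  \<open>2\<beta>\<^sub>1\<close> extreme points it gives \<open>2\<beta>\<^sub>1 \<le> deg(x)\<close>. In the case of equality the neighbours of each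
  vertex are labelled by the same directions \<open>\<plusminus>e\<^sub>1, \<dots>, \<plusminus>e\<^sub>m\<close>. Perturbing the local potential of the
  form dual to \<open>e\<^sub>i\<close> shows that weights and lengths in direction \<open>e\<^sub>j\<close> are preserved by moving along
  \<open>e\<^sub>i\<close> and that the moves commute, so they generate a simply transitive abelian group.
  Conversely, on a flat torus the translations transport the neighbours of \<open>x\<close> to those of \<open>a\<^sub>i x\<close>
  at no cost.
\<close>

section \<open>Walks, geodesics and closed forms\<close>

lemma walk_length_Nil [simp]: "walk_length g [] = 0"
  and walk_length_single [simp]: "walk_length g [x] = 0"
  by (simp_all add: walk_length_def)

lemma walk_length_Cons_Cons [simp]:
  "walk_length g (x # y # p) = g x y + walk_length g (y # p)"
  by (simp add: walk_length_def sum.lessThan_Suc_shift del: sum.lessThan_Suc)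

lemma walk_length_append:
  "walk_length g (p @ x # q) = walk_length g (p @ [x]) + walk_length g (x # q)"
proof (induction p)
  case (Cons y p)
  then show ?case by (cases p) auto
qed simp

lemma walk_betw_iff_successively:
  "walk_betw w x p y \<longleftrightarrow> p \<noteq> [] \<and> hd p = x \<and> last p = y \<and> successively (adj w) p"
  unfolding walk_betw_def successively_conv_nth by auto

text \<open>\<open>walk_length\<close> accepts any function of two arguments, so the integral of a
  form along a path obeys the same list lemmas as metric length. Closing the list with its head
  removes the modular index.\<close>

lemma coboundary_eq_walk_length:
  assumes "c \<noteq> []"
  shows "coboundary \<alpha> c = walk_length (\<lambda>x y. \<alpha> $ x $ y) (c @ [hd c])"
proof -
  have "c ! (Suc i mod length c) = (c @ [hd c]) ! Suc i" if "i < length c" for i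
  proof (cases "Suc i = length c")
    case True
    then show ?thesis using assms by (simp add: nth_append hd_conv_nth)
  next
    case False
    then show ?thesis using that by (simp add: nth_append)
  qed
  then show ?thesis
    unfolding coboundary_def walk_length_def by (auto intro!: sum.cong simp: nth_append)
qed

lemma is_cycleI:
  assumes "3 \<le> length c" "distinct c" "successively (adj w) (c @ [hd c])"
  shows "is_cycle w c"
proof -
  have "adj w (c ! i) (c ! (Suc i mod length c))" if i: "i < length c" for i
  proof -
    have "adj w ((c @ [hd c]) ! i) ((c @ [hd c]) ! Suc i)"
      using assms(3) i unfolding successively_conv_nth by auto
    moreover have "c ! (Suc i mod length c) = (c @ [hd c]) ! Suc i"
      using i assms(1) by (cases "Suc i = length c"; cases c) (auto simp: nth_append)
    ultimately show ?thesis using i by (simp add: nth_append)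
  qed
  then show ?thesis using assms by (simp add: is_cycle_def)
qed

lemma same_cycle_refl: "same_cycle c c"
  unfolding same_cycle_def by (rule exI[of _ 0]) simp

definition closed_form :: "('v::finite \<Rightarrow> 'v \<Rightarrow> real) \<Rightarrow> ('v \<Rightarrow> 'v \<Rightarrow> real) \<Rightarrow> real^'v^'v \<Rightarrow> bool" where
  "closed_form w d b \<longleftrightarrow> b \<in> one_forms w \<and> (\<forall>c\<in>X2 w d. coboundary b c = 0)"

definition dform :: "('v::finite \<Rightarrow> 'v \<Rightarrow> real) \<Rightarrow> ('v \<Rightarrow> real) \<Rightarrow> real^'v^'v" where
  "dform w h = (\<chi> x y. if adj w x y then h y - h x else 0)"

text \<open>One-sided on purpose: for a 1-form on a symmetric graph both orientations of an edge
  occur, so this says that the sup norm of b relative to d is at most s.\<close>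

definition form_le :: "('v::finite \<Rightarrow> 'v \<Rightarrow> real) \<Rightarrow> ('v \<Rightarrow> 'v \<Rightarrow> real) \<Rightarrow> real \<Rightarrow> real^'v^'v \<Rightarrow> bool" where
  "form_le w d s b \<longleftrightarrow> (\<forall>x y. adj w x y \<longrightarrow> b $ x $ y \<le> s * d x y)"

section \<open>The path metric and its geodesics\<close>

locale metric_graph =
  fixes w :: "'v::finite \<Rightarrow> 'v \<Rightarrow> real" and \<mu> :: "'v \<Rightarrow> real" and d :: "'v \<Rightarrow> 'v \<Rightarrow> real"
  assumes graph: "connected_weighted_graph w \<mu>"
    and path_distance: "general_path_distance w d"
begin

abbreviation nbh :: "'v \<Rightarrow> 'v set" where "nbh x \<equiv> {z. z = x \<or> adj w x z}"

lemma w_nonneg [simp]: "0 \<le> w x y"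
  and w_sym: "w x y = w y x"
  and \<mu>_pos [simp]: "0 < \<mu> x"
  and w_diag [simp]: "w x x = 0"
  and reachable: "(adj w)\<^sup>*\<^sup>* x y"
  using graph by (auto simp: connected_weighted_graph_def)

lemma adj_sym: "adj w x y \<longleftrightarrow> adj w y x"
  by (simp add: adj_def w_sym)

lemma adj_irrefl [simp]: "\<not> adj w x x"
  by (simp add: adj_def)

lemma w_eq_0: "\<not> adj w x y \<Longrightarrow> w x y = 0"
  using w_nonneg[of x y] by (simp add: adj_def)

lemma d_nonneg [simp]: "0 \<le> d x y"
  and d_sym: "d x y = d y x"
  and d_eq_0 [simp]: "d x y = 0 \<longleftrightarrow> x = y"
  and d_Inf: "d x y = Inf {walk_length d p | p. walk_betw w x p y}"
  using path_distance unfolding general_path_distance_def by blast+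

lemma d_diag [simp]: "d x x = 0"
  by simp

lemma d_pos: "x \<noteq> y \<Longrightarrow> 0 < d x y"
  using d_nonneg[of x y] d_eq_0[of x y] by linarith

lemma adj_d_pos: "adj w x y \<Longrightarrow> 0 < d x y"
  by (rule d_pos) auto

lemma walk_length_nonneg [simp]: "0 \<le> walk_length d p"
  by (simp add: walk_length_def sum_nonneg)

lemma d_le_walk_length:
  assumes "walk_betw w x p y"
  shows "d x y \<le> walk_length d p"
proof -
  have "bdd_below {walk_length d p | p. walk_betw w x p y}"
    by (rule bdd_belowI[of _ 0]) auto
  then show ?thesis
    unfolding d_Inf[of x y] using assms by (intro cInf_lower) auto
qed

lemma walk_exists: "\<exists>p. walk_betw w x p y"
  using reachable[of x y]
proof (induction rule: rtranclp_induct)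
  case base
  show ?case by (rule exI[of _ "[x]"]) (simp add: walk_betw_iff_successively)
next
  case (step y z)
  then obtain p where "walk_betw w x p y" by blast
  then have "walk_betw w x (p @ [z]) z"
    using step.hyps by (auto simp: walk_betw_iff_successively successively_append_iff)
  then show ?case by blast
qed

text \<open>The infimum is attained because edge lengths are bounded below by some \<delta> > 0: the
  walks no longer than a given one have bounded length as lists, so there are finitely many.\<close>

lemma geodesic_exists:
  obtains p where "walk_betw w x p y" "walk_length d p = d x y"
proof -
  let ?L = "{walk_length d p | p. walk_betw w x p y}"
  obtain p0 where p0: "walk_betw w x p0 y" using walk_exists by blast
  define L where "L = walk_length d p0"
  obtain \<delta> where \<delta>: "0 < \<delta>" "\<And>u v. adj w u v \<Longrightarrow> \<delta> \<le> d u v"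
  proof
    \<comment> \<open>The 1 keeps the set nonempty on a graph without edges.\<close>
    let ?D = "insert 1 {d u v | u v. adj w u v}"
    have fin: "finite ?D" by (rule finite_subset[of _ "insert 1 (range (\<lambda>(u, v). d u v))"]) auto
    show "0 < Min ?D" using fin adj_d_pos by (subst Min_gr_iff) auto
    show "Min ?D \<le> d u v" if "adj w u v" for u v
      using fin that by (intro Min_le) auto
  qed
  obtain n :: nat where n: "L / \<delta> + 1 \<le> real n" using real_arch_simple by blast
  have "length p \<le> n" if p: "walk_betw w x p y" "walk_length d p \<le> L" for p
  proof -
    have "real (length p - 1) * \<delta> \<le> walk_length d p"
      unfolding walk_length_def
      using sum_bounded_below[of "{..<length p - 1}" \<delta> "\<lambda>k. d (p ! k) (p ! Suc k)"] \<delta>(2) p(1)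
      by (auto simp: walk_betw_def)
    then have "real (length p - 1) \<le> L / \<delta>"
      using p(2) \<delta>(1) by (simp add: field_simps)
    with n show ?thesis by linarith
  qed
  then have "{p. walk_betw w x p y \<and> walk_length d p \<le> L} \<subseteq> {p. set p \<subseteq> UNIV \<and> length p \<le> n}"
    by auto
  then have fin: "finite {p. walk_betw w x p y \<and> walk_length d p \<le> L}"
    by (rule finite_subset) (rule finite_lists_length_le, simp)
  define M where "M = Min (walk_length d ` {p. walk_betw w x p y \<and> walk_length d p \<le> L})"
  have ne: "walk_length d ` {p. walk_betw w x p y \<and> walk_length d p \<le> L} \<noteq> {}"
    using p0 by (auto simp: L_def)
  have "M \<in> walk_length d ` {p. walk_betw w x p y \<and> walk_length d p \<le> L}"
    unfolding M_def by (rule Min_in) (use fin ne in auto)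
  then obtain p where p: "walk_betw w x p y" "walk_length d p \<le> L" "walk_length d p = M" by blast
  have "M \<le> walk_length d q" if "walk_betw w x q y" for q
  proof (cases "walk_length d q \<le> L")
    case True
    then show ?thesis unfolding M_def using fin that by (intro Min_le) auto
  next
    case False
    then show ?thesis using p by linarith
  qed
  then have "M \<le> d x y"
    unfolding d_Inf[of x y] using p0 by (intro cInf_greatest) auto
  then show ?thesis using that p d_le_walk_length[OF p(1)] by force
qed

lemma d_triangle: "d x z \<le> d x y + d y z"
proof -
  obtain p where p: "walk_betw w x p y" "walk_length d p = d x y" by (rule geodesic_exists)
  obtain q where q: "walk_betw w y q z" "walk_length d q = d y z" by (rule geodesic_exists)
  obtain p' where p': "p = p' @ [y]"
    using p(1) by (metis walk_betw_def append_butlast_last_id)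
  obtain q' where q': "q = y # q'"
    using q(1) by (metis walk_betw_def list.collapse)
  have "walk_betw w x (p' @ y # q') z"
    using p(1) q(1) unfolding p' q' walk_betw_iff_successively
    by (cases p') (auto simp: successively_append_iff simp flip: append_Cons)
  from d_le_walk_length[OF this] show ?thesis
    using p(2) q(2) walk_length_append[of d p' y q'] unfolding p' q' by simp
qed

text \<open>Each piece is at least as long as the distance it spans, and together they are as long
  as the distance of the ends. The triangle inequality therefore leaves no slack anywhere.\<close>

lemma geodesic_split:
  assumes "geodesic w d (p @ x # q)"
  shows "geodesic w d (p @ [x])" "geodesic w d (x # q)"
    "d (hd (p @ [x])) (last (x # q)) = d (hd (p @ [x])) x + d x (last (x # q))"
proof -
  have hd: "hd (p @ x # q) = hd (p @ [x])" by (cases p) auto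
  have last: "last (p @ x # q) = last (x # q)" by auto
  have "walk_betw w (hd (p @ [x])) (p @ x # q) (last (x # q))"
    using assms unfolding geodesic_def hd last by simp
  then have s: "successively (adj w) (p @ x # q)" by (simp add: walk_betw_iff_successively)
  then have 1: "walk_betw w (hd (p @ [x])) (p @ [x]) x"
    and 2: "walk_betw w x (x # q) (last (x # q))"
    by (auto simp: walk_betw_iff_successively successively_append_iff)
  have len: "walk_length d (p @ [x]) + walk_length d (x # q) = d (hd (p @ [x])) (last (x # q))"
    using assms unfolding geodesic_def hd last walk_length_append[of d p x q] by simp
  note bounds = d_le_walk_length[OF 1] d_le_walk_length[OF 2]
    d_triangle[of "hd (p @ [x])" "last (x # q)" x]
  show "d (hd (p @ [x])) (last (x # q)) = d (hd (p @ [x])) x + d x (last (x # q))"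
    using bounds len by linarith
  have "walk_length d (p @ [x]) = d (hd (p @ [x])) x" "walk_length d (x # q) = d x (last (x # q))"
    using bounds len by linarith+
  then show "geodesic w d (p @ [x])" "geodesic w d (x # q)"
    unfolding geodesic_def using 1 2 by auto
qed

text \<open>A repeated vertex would cut out a closed geodesic: its length is 0, yet it contains an
  edge.\<close>

lemma geodesic_distinct:
  assumes "geodesic w d p"
  shows "distinct p"
proof (rule ccontr)
  assume "\<not> distinct p"
  then obtain a b c x where p: "p = a @ [x] @ b @ [x] @ c" using not_distinct_decomp by blast
  have "geodesic w d (x # b @ x # c)" using geodesic_split(2)[of a x] assms p by simp
  then have g: "geodesic w d ((x # b) @ [x])" using geodesic_split(1)[of "x # b" x c] by simp
  then obtain y r where "(x # b) @ [x] = x # y # r" by (cases b) auto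
  then have "adj w x y" "walk_length d ((x # b) @ [x]) = d x y + walk_length d (y # r)"
    using g by (auto simp: geodesic_def walk_betw_iff_successively)
  moreover have "walk_length d ((x # b) @ [x]) = 0" using g by (simp add: geodesic_def)
  ultimately show False using adj_d_pos[of x y] walk_length_nonneg[of "y # r"] by linarith
qed

section \<open>Closed forms around short cycles\<close>

lemma X2_triangle:
  assumes "adj w x y" "adj w y z" "adj w z x"
  shows "[x, y, z] \<in> X2 w d"
proof -
  have "is_cycle w [x, y, z]"
    using assms by (intro is_cycleI) auto
  then show ?thesis unfolding X2_def using same_cycle_refl by fastforce
qed

text \<open>The cycle lies in \<open>X2\<close> without any strictness assumption. If q is empty it
  is a triangle. Otherwise the vertex a after z on the geodesic is strictly closer to x than z is,
  so x, y, z, a satisfy the strict inequality and the rest of the geodesic closes the cycle.\<close>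

lemma closed_form_two_path:
  assumes b: "closed_form w d b" and "adj w x y" "adj w y z"
    and g: "geodesic w d (z # q @ [x])" and y: "y \<notin> set q"
  shows "b $ x $ y + b $ y $ z + walk_length (\<lambda>x y. b $ x $ y) (z # q @ [x]) = 0"
proof -
  let ?c = "x # y # z # q"
  have dist: "distinct (z # q @ [x])" using geodesic_distinct[OF g] .
  have s: "successively (adj w) (z # q @ [x])"
    using g by (simp add: geodesic_def walk_betw_iff_successively)
  have cyc: "is_cycle w ?c"
    using assms dist s by (intro is_cycleI) (auto)
  have "?c \<in> X2 w d"
  proof (cases q)
    case Nil
    then show ?thesis using cyc same_cycle_refl[of ?c] unfolding X2_def by force
  next
    case (Cons a r)
    have "d z x = d z a + d a x" "geodesic w d (a # r @ [x])"
      using geodesic_split[of "[z]" a "r @ [x]"] g Cons by auto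
    then have "d x a < d x y + d y z + d z a"
      using d_triangle[of x z y] adj_d_pos[of z a] s Cons d_sym[of z x] d_sym[of a x]
      by auto
    then show ?thesis
      using cyc same_cycle_refl[of ?c] \<open>geodesic w d (a # r @ [x])\<close> Cons unfolding X2_def
      by (intro CollectI conjI exI[of _ ?c]) (auto simp: numeral_3_eq_3)
  qed
  then have "coboundary b ?c = 0" using b by (simp add: closed_form_def)
  then show ?thesis by (simp add: coboundary_eq_walk_length)
qed

lemma closed_form_three_path:
  assumes b: "closed_form w d b" and "adj w u x" "adj w x y" "adj w y v"
    and g: "geodesic w d (v # q @ [u])" and "x \<notin> set (v # q @ [u])" "y \<notin> set (v # q @ [u])"
    and lt: "d u v < d u x + d x y + d y v"
  shows "b $ u $ x + b $ x $ y + b $ y $ v + walk_length (\<lambda>x y. b $ x $ y) (v # q @ [u]) = 0"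
proof -
  let ?c = "u # x # y # v # q"
  have dist: "distinct (v # q @ [u])" using geodesic_distinct[OF g] .
  have s: "successively (adj w) (v # q @ [u])"
    using g by (simp add: geodesic_def walk_betw_iff_successively)
  have cyc: "is_cycle w ?c"
    using assms dist s by (intro is_cycleI) auto
  then have "?c \<in> X2 w d"
    using same_cycle_refl[of ?c] g lt unfolding X2_def
    by (intro CollectI conjI exI[of _ ?c]) (auto simp: numeral_3_eq_3)
  then have "coboundary b ?c = 0" using b by (simp add: closed_form_def)
  then show ?thesis by (simp add: coboundary_eq_walk_length)
qed

section \<open>Lipschitz bounds for closed forms\<close>

lemma one_form_antisym: "b \<in> one_forms w \<Longrightarrow> b $ x $ y = - b $ y $ x"
  unfolding one_forms_def mem_Collect_eq using adj_sym[of x y] by (metis neg_0_equal_iff_equal)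

lemma one_form_diag [simp]: "b \<in> one_forms w \<Longrightarrow> b $ x $ x = 0"
  unfolding one_forms_def mem_Collect_eq by (metis adj_irrefl)

lemma closed_form_one_form: "closed_form w d b \<Longrightarrow> b \<in> one_forms w"
  by (simp add: closed_form_def)

text \<open>The minus sign fits the use: where a closed form sums to 0 around a cycle, its integral
  over one arc is minus that over the geodesic that returns.\<close>

lemma form_le_walk_length:
  assumes "b \<in> one_forms w" "form_le w d s b" "successively (adj w) p"
  shows "- walk_length (\<lambda>x y. b $ x $ y) p \<le> s * walk_length d p"
  using assms(3)
proof (induction p rule: induct_list012)
  case (3 x y p)
  have "b $ y $ x \<le> s * d x y"
    using assms(2) 3(3) adj_sym d_sym unfolding form_le_def by (metis successively.simps(3))
  then show ?case
    using 3 one_form_antisym[OF assms(1), of x y] by (auto simp: algebra_simps)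
qed auto

lemma form_le_nonneg:
  assumes "b \<in> one_forms w" "form_le w d s b" "adj w x y"
  shows "0 \<le> s"
proof -
  have "b $ x $ y \<le> s * d x y" "b $ y $ x \<le> s * d x y"
    using assms adj_sym d_sym unfolding form_le_def by metis+
  then have "0 \<le> s * d x y" using one_form_antisym[OF assms(1), of x y] by linarith
  then show ?thesis using adj_d_pos[OF assms(3)] by (simp add: zero_le_mult_iff)
qed

lemma form_le_nbh:
  assumes "b \<in> one_forms w" "form_le w d s b" "y \<in> nbh x"
  shows "b $ x $ y \<le> s * d x y" "- b $ x $ y \<le> s * d x y"
proof -
  show 1: "b $ x $ y \<le> s * d x y"
    using assms unfolding form_le_def by auto
  have "b $ y $ x \<le> s * d y x"
    using assms adj_sym unfolding form_le_def by auto
  then show "- b $ x $ y \<le> s * d x y"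
    using one_form_antisym[OF assms(1), of x y] d_sym[of x y] by simp
qed

lemma geodesic_exists_Cons_snoc:
  assumes "x \<noteq> y"
  obtains q where "geodesic w d (x # q @ [y])" "walk_length d (x # q @ [y]) = d x y"
proof -
  obtain p where p: "walk_betw w x p y" "walk_length d p = d x y" by (rule geodesic_exists)
  have "p \<noteq> []" "hd p = x" "last p = y" using p(1) by (auto simp: walk_betw_def)
  then obtain q where "p = x # q @ [y]"
    using assms by (metis append_butlast_last_id last_ConsL list.collapse list.sel(3) last_tl butlast.simps(2) append_Cons)
  then show ?thesis using that p by (auto simp: geodesic_def)
qed

text \<open>Close the path u, x, v by a geodesic from v to u; the form sums to 0 around this cycle
  and is bounded on the geodesic. If the geodesic passes through x, the distance splits at x and the
  bounds on the two edges suffice.\<close>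

lemma lipschitz_two_path:
  assumes b: "closed_form w d b" and le: "form_le w d s b"
    and u: "u \<in> nbh x" and v: "v \<in> nbh x"
  shows "b $ x $ v - b $ x $ u \<le> s * d u v"
proof (cases "u = v \<or> u = x \<or> v = x")
  case True
  note of = closed_form_one_form[OF b]
  show ?thesis
    using True form_le_nbh[OF of le u] form_le_nbh[OF of le v] of d_sym[of u x]
    by auto
next
  case False
  note of = closed_form_one_form[OF b]
  obtain q where q: "geodesic w d (v # q @ [u])" "walk_length d (v # q @ [u]) = d v u"
    using geodesic_exists_Cons_snoc False by metis
  show ?thesis
  proof (cases "x \<in> set q")
    case True
    then obtain q1 q2 where "v # q @ [u] = (v # q1) @ x # (q2 @ [u])"
      by (metis split_list append_Cons append_assoc)
    then have "d v u = d v x + d x u"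
      using geodesic_split(3)[of "v # q1" x "q2 @ [u]"] q(1) by auto
    then show ?thesis
      using form_le_nbh[OF of le u] form_le_nbh[OF of le v] d_sym[of v x] d_sym[of v u]
      by (simp add: algebra_simps)
  next
    case notin: False
    have "b $ u $ x + b $ x $ v + walk_length (\<lambda>x y. b $ x $ y) (v # q @ [u]) = 0"
      using closed_form_two_path[OF b _ _ q(1) notin] u v False adj_sym by auto
    moreover have "- walk_length (\<lambda>x y. b $ x $ y) (v # q @ [u]) \<le> s * d v u"
      using form_le_walk_length[OF of le, of "v # q @ [u]"] q
      by (simp add: geodesic_def walk_betw_iff_successively)
    ultimately show ?thesis using one_form_antisym[OF of, of u x] d_sym[of u v] by simp
  qed
qed

text \<open>As for two edges, with a geodesic from v back to u. If it meets x or y, the distance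
  splits there and the two-edge bound applies. If it avoids both and is strictly shorter than u, x,
  y, v, the cycle is in \<open>X2\<close>. If it is not strictly shorter, the bounds on the three
  edges add up. For u = v the cycle is a triangle.\<close>

lemma lipschitz_three_path:
  assumes b: "closed_form w d b" and le: "form_le w d s b" and xy: "adj w x y"
    and u: "u \<in> nbh x" and v: "v \<in> nbh y"
  shows "b $ x $ y + b $ y $ v - b $ x $ u \<le> s * d u v"
proof -
  note of = closed_form_one_form[OF b]
  have s: "0 \<le> s" using form_le_nonneg[OF of le xy] .
  have yx: "x \<in> nbh y" "y \<in> nbh x" using xy adj_sym by auto
  have b_yx: "b $ y $ x = - b $ x $ y" using one_form_antisym[OF of] .
  have ux: "- b $ x $ u \<le> s * d u x" using form_le_nbh[OF of le u] d_sym by metis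
  have xv: "b $ x $ y + b $ y $ v \<le> s * d x v"
    using lipschitz_two_path[OF b le yx(1) v] b_yx by simp
  have uy: "b $ x $ y - b $ x $ u \<le> s * d u y"
    using lipschitz_two_path[OF b le u yx(2)] by simp
  have yv: "b $ y $ v \<le> s * d y v" using form_le_nbh[OF of le v] by simp
  have via: ?thesis if "z = x \<or> z = y" "d u v = d u z + d z v" for z
    using that ux xv uy yv by (auto simp: algebra_simps)
  show ?thesis
  proof (cases "u = x \<or> v = y \<or> u = y \<or> v = x")
    case True
    then show ?thesis using via[of x] via[of y] by auto
  next
    case False
    show ?thesis
    proof (cases "u = v")
      case True
      have "[x, y, v] \<in> X2 w d" using X2_triangle[of x y v] xy u v False True adj_sym by auto
      then have "b $ x $ y + b $ y $ v + b $ v $ x = 0"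
        using b by (auto simp: closed_form_def coboundary_eq_walk_length)
      then show ?thesis using one_form_antisym[OF of, of v x] True by simp
    next
      case uv: False
      obtain q where q: "geodesic w d (v # q @ [u])" "walk_length d (v # q @ [u]) = d v u"
        using geodesic_exists_Cons_snoc uv by metis
      show ?thesis
      proof (cases "x \<in> set q \<or> y \<in> set q")
        case True
        then obtain z where z: "z = x \<or> z = y" "z \<in> set q" by blast
        then obtain q1 q2 where "v # q @ [u] = (v # q1) @ z # (q2 @ [u])"
          by (metis split_list append_Cons append_assoc)
        then have "d v u = d v z + d z u"
          using geodesic_split(3)[of "v # q1" z "q2 @ [u]"] q(1) by auto
        then show ?thesis using via[OF z(1)] d_sym[of u v] d_sym[of u z] d_sym[of z v] by simp
      next
        case notin: False
        show ?thesis
        proof (cases "d u v < d u x + d x y + d y v")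
          case True
          have "b $ u $ x + b $ x $ y + b $ y $ v
              + walk_length (\<lambda>x y. b $ x $ y) (v # q @ [u]) = 0"
            using closed_form_three_path[OF b _ xy _ q(1) _ _ True] notin False u v adj_sym
            by auto
          moreover have "- walk_length (\<lambda>x y. b $ x $ y) (v # q @ [u]) \<le> s * d v u"
            using form_le_walk_length[OF of le, of "v # q @ [u]"] q
            by (simp add: geodesic_def walk_betw_iff_successively)
          ultimately show ?thesis using one_form_antisym[OF of, of u x] d_sym[of u v] by simp
        next
          case ge: False
          have "b $ x $ y \<le> s * d x y" using form_le_nbh[OF of le yx(2)] by simp
          then have "b $ x $ y + b $ y $ v - b $ x $ u \<le> s * (d u x + d x y + d y v)"
            using ux yv by (simp add: algebra_simps)
          also have "\<dots> \<le> s * d u v" using ge s by (intro mult_left_mono) auto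
          finally show ?thesis .
        qed
      qed
    qed
  qed
qed

end

section \<open>Curvature and local potentials\<close>

context metric_graph begin

lemma laplacian_cong:
  assumes "\<And>z. z \<in> nbh x \<Longrightarrow> f z = g z"
  shows "laplacian w \<mu> f x = laplacian w \<mu> g x"
  unfolding laplacian_def
proof (rule sum.cong)
  fix y
  show "w x y / \<mu> x * (f y - f x) = w x y / \<mu> x * (g y - g x)"
    using assms[of x] assms[of y] by (cases "adj w x y") (auto simp: w_eq_0)
qed simp

lemma laplacian_scale: "laplacian w \<mu> (\<lambda>z. c * f z) x = c * laplacian w \<mu> f x"
  unfolding laplacian_def sum_distrib_left by (rule sum.cong) (auto simp: algebra_simps diff_divide_distrib)

lemma laplacian_diff:
  "laplacian w \<mu> (\<lambda>z. f z - g z) x = laplacian w \<mu> f x - laplacian w \<mu> g x"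
  unfolding laplacian_def sum_subtractf[symmetric] by (rule sum.cong) (auto simp: algebra_simps add_divide_distrib diff_divide_distrib)

section \<open>Curvature in terms of 1-Lipschitz functions\<close>

lemma grad_norm_eq_1I:
  assumes lip: "\<And>a b. f b - f a \<le> d a b" and "x \<noteq> y" "f y - f x = d x y"
  shows "grad_norm d f = 1"
  unfolding grad_norm_def
proof (rule cSup_eq_maximum)
  have "grad d y x f = 1"
    unfolding grad_def using assms(2,3) d_pos[OF assms(2)] d_sym[of x y] by simp
  then show "1 \<in> {\<bar>grad d x y f\<bar> | x y. x \<noteq> y}"
    using assms(2) by (intro CollectI exI[of _ y] exI[of _ x]) auto
next
  fix r assume "r \<in> {\<bar>grad d x y f\<bar> | x y. x \<noteq> y}"
  then obtain a b where ab: "a \<noteq> b" "r = \<bar>grad d a b f\<bar>" by blast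
  have "\<bar>f a - f b\<bar> \<le> d a b"
    using lip[of a b] lip[of b a] d_sym[of a b] by linarith
  then show "r \<le> 1"
    using ab d_pos[OF ab(1)] by (simp add: grad_def)
qed

lemma grad_norm_1_lipschitz:
  assumes "grad_norm d f = 1"
  shows "\<bar>f a - f b\<bar> \<le> d a b"
proof (cases "a = b")
  case False
  have "finite {\<bar>grad d x y f\<bar> | x y. x \<noteq> y}"
    by (rule finite_subset[of _ "range (\<lambda>(x, y). \<bar>grad d x y f\<bar>)"]) auto
  then have "\<bar>grad d a b f\<bar> \<le> grad_norm d f"
    unfolding grad_norm_def using False by (intro cSup_upper) auto
  then show ?thesis
    using assms d_pos[OF False] by (simp add: grad_def)
qed simp

text \<open>A real \<open>Inf\<close> is a lower bound only for sets bounded below. Here the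
  Laplacian of a 1-Lipschitz function at z is controlled by C z, the weighted sum of the edge
  lengths at z.\<close>

lemma ollivier_curvature_bdd_below:
  assumes xy: "x \<noteq> y"
  shows "bdd_below {grad d x y (laplacian w \<mu> f) | f. grad d y x f = 1 \<and> grad_norm d f = 1}"
proof -
  define C where "C z = (\<Sum>y\<in>UNIV. w z y / \<mu> z * d z y)" for z
  have "\<bar>laplacian w \<mu> f z\<bar> \<le> C z" if "grad_norm d f = 1" for f z
  proof -
    have "\<bar>w z y / \<mu> z * (f y - f z)\<bar> \<le> w z y / \<mu> z * d z y" for y
      using grad_norm_1_lipschitz[OF that, of y z] d_sym[of y z]
      by (simp add: abs_mult divide_right_mono mult_left_mono less_imp_le)
    then show ?thesis
      unfolding laplacian_def C_def by (intro order_trans[OF sum_abs] sum_mono)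
  qed
  note C = this
  have "- (C x + C y) / d x y \<le> grad d x y (laplacian w \<mu> f)" if "grad_norm d f = 1" for f
    unfolding grad_def using d_pos[OF xy] C[OF that, of x] C[OF that, of y]
    by (intro divide_right_mono) linarith+
  then show ?thesis by (intro bdd_belowI[of _ "- (C x + C y) / d x y"]) auto
qed

lemma nonneg_ollivier_curvatureI:
  assumes "\<And>x y f. adj w x y \<Longrightarrow> (\<And>a b. f b - f a \<le> d a b) \<Longrightarrow> f y - f x = d x y \<Longrightarrow>
    laplacian w \<mu> f y \<le> laplacian w \<mu> f x"
  shows "nonneg_ollivier_curvature w \<mu> d"
  unfolding nonneg_ollivier_curvature_def
proof (intro allI impI)
  fix x y assume xy: "adj w x y"
  then have ne: "x \<noteq> y" by auto
  let ?S = "{grad d x y (laplacian w \<mu> f) | f. grad d y x f = 1 \<and> grad_norm d f = 1}"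
  \<comment> \<open>The distance from x is an admissible function, so the infimum is not taken over
    the empty set.\<close>
  have "grad_norm d (d x) = 1"
    by (rule grad_norm_eq_1I[OF _ ne]) (use d_triangle[of x] in \<open>auto simp: diff_le_eq add.commute\<close>)
  moreover have "grad d y x (d x) = 1"
    using ne d_sym[of x y] d_pos[OF ne] by (simp add: grad_def)
  ultimately have "?S \<noteq> {}" by blast
  moreover have "0 \<le> r" if "r \<in> ?S" for r
  proof -
    from that obtain f where f: "r = grad d x y (laplacian w \<mu> f)" "grad d y x f = 1"
      "grad_norm d f = 1" by blast
    have "f b - f a \<le> d a b" for a b
      using grad_norm_1_lipschitz[OF f(3), of a b] by linarith
    moreover have "f y - f x = d x y"
      using f(2) d_pos[OF ne] d_sym[of x y] by (simp add: grad_def)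
    ultimately have "laplacian w \<mu> f y \<le> laplacian w \<mu> f x" using assms[OF xy] by blast
    then show ?thesis using f(1) d_pos[OF ne] by (simp add: grad_def)
  qed
  ultimately show "0 \<le> ollivier_curvature w \<mu> d x y"
    unfolding ollivier_curvature_def by (intro cInf_greatest) auto
qed

section \<open>Differentials of functions and local potentials\<close>

lemma coboundary_adjoint_dform: "coboundary_adjoint w \<mu> (dform w h) x = laplacian w \<mu> h x"
  unfolding coboundary_adjoint_def laplacian_def dform_def
  by (rule sum.cong) (auto simp: w_eq_0)

lemma coboundary_adjoint_scale:
  "coboundary_adjoint w \<mu> (c *\<^sub>R b) x = c * coboundary_adjoint w \<mu> b x"
  unfolding coboundary_adjoint_def sum_distrib_left by (rule sum.cong) auto

lemma coboundary_adjoint_add: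
  "coboundary_adjoint w \<mu> (a + b) x = coboundary_adjoint w \<mu> a x + coboundary_adjoint w \<mu> b x"
  unfolding coboundary_adjoint_def sum.distrib[symmetric] by (rule sum.cong) (auto simp: algebra_simps add_divide_distrib diff_divide_distrib)

lemma coboundary_scale: "coboundary (c *\<^sub>R b) p = c * coboundary b p"
  unfolding coboundary_def sum_distrib_left by (rule sum.cong) auto

lemma coboundary_add: "coboundary (a + b) p = coboundary a p + coboundary b p"
  unfolding coboundary_def sum.distrib[symmetric] by (rule sum.cong) auto

lemma dform_one_form: "dform w h \<in> one_forms w"
  by (auto simp: one_forms_def dform_def adj_sym)

lemma closed_form_dform: "closed_form w d (dform w h)"
  unfolding closed_form_def
proof (intro conjI ballI dform_one_form)
  fix c assume "c \<in> X2 w d"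
  then have c: "is_cycle w c" by (simp add: X2_def)
  then have ne: "c \<noteq> []" by (auto simp: is_cycle_def)
  have "coboundary (dform w h) c
      = (\<Sum>i<length c. h (c ! (Suc i mod length c)) - h (c ! i))"
    unfolding coboundary_def using c by (intro sum.cong) (auto simp: dform_def is_cycle_def)
  also have "\<dots> = (\<Sum>i<length c. h ((c @ [hd c]) ! Suc i) - h ((c @ [hd c]) ! i))"
  proof (rule sum.cong)
    fix i assume "i \<in> {..<length c}"
    then show "h (c ! (Suc i mod length c)) - h (c ! i)
        = h ((c @ [hd c]) ! Suc i) - h ((c @ [hd c]) ! i)"
      using ne by (cases "Suc i = length c") (auto simp: nth_append hd_conv_nth)
  qed simp
  also have "\<dots> = 0"
    using ne sum_lessThan_telescope[of "\<lambda>i. h ((c @ [hd c]) ! i)" "length c"]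
    by (simp add: hd_append flip: hd_conv_nth)
  finally show "coboundary (dform w h) c = 0" .
qed

lemma closed_form_add_scale:
  assumes "closed_form w d a" "closed_form w d b"
  shows "closed_form w d (a + t *\<^sub>R b)"
proof -
  have "a + t *\<^sub>R b \<in> one_forms w"
    using assms unfolding closed_form_def one_forms_def
    by (simp add: algebra_simps)
  then show ?thesis
    using assms by (auto simp: closed_form_def coboundary_add coboundary_scale)
qed

text \<open>A local primitive of b around the edge x y, normalised to vanish at x. Only its values
  on \<open>nbh x\<close> and \<open>nbh y\<close> matter.\<close>

definition potential :: "real^'v^'v \<Rightarrow> 'v \<Rightarrow> 'v \<Rightarrow> 'v \<Rightarrow> real" where
  "potential b x y z = (if z \<in> nbh x then b $ x $ z else b $ x $ y + b $ y $ z)"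

text \<open>On a common neighbour of x and y the two formulas agree because triangles belong to
  \<open>X2\<close>.\<close>

lemma potential_nbh:
  assumes "closed_form w d b" "form_le w d s b" "adj w x y"
  shows "z \<in> nbh x \<Longrightarrow> potential b x y z = b $ x $ z"
    and "z \<in> nbh y \<Longrightarrow> potential b x y z = b $ x $ y + b $ y $ z"
proof -
  show "z \<in> nbh x \<Longrightarrow> potential b x y z = b $ x $ z" by (simp add: potential_def)
  assume z: "z \<in> nbh y"
  show "potential b x y z = b $ x $ y + b $ y $ z"
  proof (cases "z \<in> nbh x")
    case True
    note of = closed_form_one_form[OF assms(1)]
    have "b $ x $ z = b $ x $ y + b $ y $ z"
    proof (cases "z = x \<or> z = y")
      case True
      then show ?thesis using of one_form_antisym[OF of, of y x] by auto
    next
      case False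
      have "[x, y, z] \<in> X2 w d" using X2_triangle[of x y z] assms(3) z True False adj_sym by auto
      then have "b $ x $ y + b $ y $ z + b $ z $ x = 0"
        using assms(1) by (auto simp: closed_form_def coboundary_eq_walk_length)
      then show ?thesis using one_form_antisym[OF of, of z x] by simp
    qed
    then show ?thesis using True by (simp add: potential_def)
  qed (simp add: potential_def)
qed

lemma potential_lipschitz:
  assumes b: "closed_form w d b" "form_le w d s b" "adj w x y"
    and "u \<in> nbh x \<union> nbh y" "v \<in> nbh x \<union> nbh y"
  shows "potential b x y v - potential b x y u \<le> s * d u v"
proof -
  note pot = potential_nbh[OF b]
  note of = closed_form_one_form[OF b(1)]
  have yx: "adj w y x" using b(3) adj_sym by blast
  consider "u \<in> nbh x" "v \<in> nbh x" | "u \<in> nbh x" "v \<in> nbh y"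
    | "u \<in> nbh y" "v \<in> nbh x" | "u \<in> nbh y" "v \<in> nbh y"
    using assms(4,5) by blast
  then show ?thesis
  proof cases
    case 1
    show ?thesis using lipschitz_two_path[OF b(1,2) 1] pot(1)[OF 1(1)] pot(1)[OF 1(2)] by simp
  next
    case 2
    show ?thesis using lipschitz_three_path[OF b 2] pot(1)[OF 2(1)] pot(2)[OF 2(2)] by simp
  next
    case 3
    show ?thesis
      using lipschitz_three_path[OF b(1,2) yx 3] pot(2)[OF 3(1)] pot(1)[OF 3(2)]
        one_form_antisym[OF of, of y x] by simp
  next
    case 4
    show ?thesis using lipschitz_two_path[OF b(1,2) 4] pot(2)[OF 4(1)] pot(2)[OF 4(2)] by simp
  qed
qed

text \<open>The Laplacian at a vertex sees only its neighbours, so at both ends of the edge a closed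
  form can be replaced by a function, to which the curvature bound applies.\<close>

lemma laplacian_potential:
  assumes b: "closed_form w d b" "form_le w d s b" "adj w x y"
  shows "laplacian w \<mu> (potential b x y) x = coboundary_adjoint w \<mu> b x"
    and "laplacian w \<mu> (potential b x y) y = coboundary_adjoint w \<mu> b y"
proof -
  note of = closed_form_one_form[OF b(1)]
  note pot = potential_nbh[OF b]
  have "laplacian w \<mu> (potential b x y) x = laplacian w \<mu> (\<lambda>z. b $ x $ z) x"
    by (rule laplacian_cong) (use pot in auto)
  then show "laplacian w \<mu> (potential b x y) x = coboundary_adjoint w \<mu> b x"
    using of by (simp add: laplacian_def coboundary_adjoint_def)
  have "laplacian w \<mu> (potential b x y) y = laplacian w \<mu> (\<lambda>z. b $ x $ y + b $ y $ z) y"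
    by (rule laplacian_cong) (use pot in auto)
  then show "laplacian w \<mu> (potential b x y) y = coboundary_adjoint w \<mu> b y"
    using of by (simp add: laplacian_def coboundary_adjoint_def)
qed

end

section \<open>Comparison along an edge under non-negative curvature\<close>

locale nonneg_curved_graph = metric_graph w \<mu> d
  for w :: "'v::finite \<Rightarrow> 'v \<Rightarrow> real" and \<mu> and d +
  assumes nonneg_curvature: "nonneg_ollivier_curvature w \<mu> d"
begin

lemma laplacian_le_of_lipschitz:
  assumes xy: "adj w x y" and lip: "\<And>a b. f b - f a \<le> d a b" and f: "f y - f x = d x y"
  shows "laplacian w \<mu> f y \<le> laplacian w \<mu> f x"
proof -
  have ne: "x \<noteq> y" using xy by auto
  let ?S = "{grad d x y (laplacian w \<mu> f) | f. grad d y x f = 1 \<and> grad_norm d f = 1}"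
  have "grad d y x f = 1"
    using f ne d_sym[of x y] d_pos[OF ne] by (simp add: grad_def)
  moreover have "grad_norm d f = 1" using grad_norm_eq_1I[of f x y] lip ne f by blast
  ultimately have "Inf ?S \<le> grad d x y (laplacian w \<mu> f)"
    using ollivier_curvature_bdd_below[OF ne] by (intro cInf_lower) auto
  moreover have "0 \<le> Inf ?S"
    using nonneg_curvature xy
    unfolding nonneg_ollivier_curvature_def ollivier_curvature_def by blast
  ultimately have "0 \<le> grad d x y (laplacian w \<mu> f)" by linarith
  then show ?thesis using d_pos[OF ne] by (simp add: grad_def zero_le_divide_iff)
qed

text \<open>Only the values of \<open>f\<close> around the edge matter: the rest is filled in by McShane's extension.\<close>

lemma laplacian_le_of_local_lipschitz:
  assumes xy: "adj w x y" and s: "0 < s" and f: "f y - f x = s * d x y"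
    and lip: "\<And>a b. a \<in> nbh x \<union> nbh y \<Longrightarrow> b \<in> nbh x \<union> nbh y \<Longrightarrow> f b - f a \<le> s * d a b"
  shows "laplacian w \<mu> f y \<le> laplacian w \<mu> f x"
proof -
  let ?Z = "nbh x \<union> nbh y"
  define F where "F z = Min ((\<lambda>a. f a / s + d a z) ` ?Z)" for z
  have fin: "finite ((\<lambda>a. f a / s + d a z) ` ?Z)" for z by simp
  have ne: "(\<lambda>a. f a / s + d a z) ` ?Z \<noteq> {}" for z by auto
  have F_le: "F z \<le> f a / s + d a z" if "a \<in> ?Z" for a z
    unfolding F_def using that by (intro Min_le fin imageI)
  have F_ge: "r \<le> F z" if "\<And>a. a \<in> ?Z \<Longrightarrow> r \<le> f a / s + d a z" for r z
    unfolding F_def using that by (subst Min_ge_iff[OF fin ne]) blast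
  have F_eq: "F z = f z / s" if z: "z \<in> ?Z" for z
  proof (rule antisym)
    show "F z \<le> f z / s" using F_le[OF z, of z] by simp
    show "f z / s \<le> F z"
    proof (rule F_ge)
      fix a assume "a \<in> ?Z"
      from lip[OF this z] show "f z / s \<le> f a / s + d a z"
        using s by (simp add: field_simps)
    qed
  qed
  have F_lip: "F b - F a \<le> d a b" for a b
  proof -
    have "F b - d a b \<le> F a"
    proof (rule F_ge)
      fix c assume "c \<in> ?Z"
      from F_le[OF this, of b] show "F b - d a b \<le> f c / s + d c a"
        using d_triangle[of c b a] by linarith
    qed
    then show ?thesis by linarith
  qed
  have "F y - F x = d x y"
    using F_eq[of x] F_eq[of y] f s by (simp flip: diff_divide_distrib)
  from laplacian_le_of_lipschitz[OF xy F_lip this]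
  have "laplacian w \<mu> F y \<le> laplacian w \<mu> F x" .
  moreover have "laplacian w \<mu> F z = 1 / s * laplacian w \<mu> f z" if "z = x \<or> z = y" for z
  proof -
    have "laplacian w \<mu> F z = laplacian w \<mu> (\<lambda>a. 1 / s * f a) z"
      by (rule laplacian_cong) (use that F_eq in auto)
    then show ?thesis by (simp only: laplacian_scale)
  qed
  ultimately show ?thesis using s by (simp add: divide_le_cancel)
qed

text \<open>The local potential is s-Lipschitz near the edge and attains the slope s across it, so
  it is a test function for the curvature.\<close>

lemma coboundary_adjoint_le_of_tight:
  assumes b: "closed_form w d b" "form_le w d s b" "adj w x y"
    and s: "0 < s" and tight: "b $ x $ y = s * d x y"
  shows "coboundary_adjoint w \<mu> b y \<le> coboundary_adjoint w \<mu> b x"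
proof -
  have "potential b x y y - potential b x y x = s * d x y"
    using potential_nbh(1)[OF b, of x] potential_nbh(1)[OF b, of y] b(3) tight
      closed_form_one_form[OF b(1)] by simp
  from laplacian_le_of_local_lipschitz[OF b(3) s this potential_lipschitz[OF b]]
  show ?thesis by (simp add: laplacian_potential[OF b])
qed

end

section \<open>Tight edges of a harmonic form\<close>

text \<open>Serves all perturbation arguments below: finitely many positive slacks g survive a small
  multiple of a perturbation k, and the multiple can be kept below any cap c.\<close>

lemma small_multiplier_exists:
  fixes g k :: "'a \<Rightarrow> real" and c :: real
  assumes "finite A" "\<And>a. a \<in> A \<Longrightarrow> 0 < g a" "0 < c"
  obtains \<epsilon> where "0 < \<epsilon>" "\<epsilon> < c" "\<And>a. a \<in> A \<Longrightarrow> \<epsilon> * k a \<le> g a"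
proof -
  have "\<exists>\<epsilon>>0. \<epsilon> < c \<and> (\<forall>a\<in>A. \<epsilon> * k a \<le> g a)"
    using assms(1,2)
  proof (induction A rule: finite_induct)
    case empty
    show ?case using assms(3) by (intro exI[of _ "c / 2"]) auto
  next
    case (insert a A)
    then obtain \<epsilon> where \<epsilon>: "0 < \<epsilon>" "\<epsilon> < c" "\<forall>a\<in>A. \<epsilon> * k a \<le> g a" by auto
    define \<delta> where "\<delta> = min \<epsilon> (g a / (\<bar>k a\<bar> + 1))"
    have ga: "0 < g a" using insert.prems by auto
    have \<delta>: "0 < \<delta>" "\<delta> \<le> \<epsilon>" "\<delta> \<le> g a / (\<bar>k a\<bar> + 1)"
      using \<epsilon> ga by (auto simp: \<delta>_def)
    have "\<delta> * k a \<le> \<delta> * (\<bar>k a\<bar> + 1)" using \<delta>(1) by (intro mult_left_mono) auto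
    also have "\<dots> \<le> g a" using \<delta>(3) by (simp add: pos_le_divide_eq)
    finally have "\<delta> * k a \<le> g a" .
    moreover have "\<delta> * k a' \<le> g a'" if a': "a' \<in> A" for a'
    proof (cases "0 \<le> k a'")
      case True
      then have "\<delta> * k a' \<le> \<epsilon> * k a'" using \<delta>(2) by (intro mult_right_mono)
      then show ?thesis using \<epsilon>(3) a' by fastforce
    next
      case False
      then have "\<delta> * k a' \<le> 0" using \<delta>(1) by (simp add: mult_le_0_iff)
      then show ?thesis using insert.prems a' by fastforce
    qed
    ultimately show ?case using \<delta>(1,2) \<epsilon>(2) by (intro exI[of _ \<delta>]) auto
  qed
  then show ?thesis using that by blast
qed

section \<open>Energy and bounded representatives of a cohomology class\<close>

context metric_graph begin

lemma one_form_add: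
  assumes "a \<in> one_forms w" "b \<in> one_forms w"
  shows "a + b \<in> one_forms w"
proof -
  have "(a + b) $ x $ y = - (a + b) $ y $ x" for x y
    using one_form_antisym[OF assms(1), of x y] one_form_antisym[OF assms(2), of x y] by simp
  moreover have "(a + b) $ x $ y = 0" if "\<not> adj w x y" for x y
    using assms that unfolding one_forms_def by auto
  ultimately show ?thesis unfolding one_forms_def by blast
qed

text \<open>Summation by parts. Antisymmetry of b and symmetry of w make the terms with g y and
  those with g x contribute equally, hence the factor 2.\<close>

lemma sum_form_dform:
  assumes "b \<in> one_forms w"
  shows "(\<Sum>x\<in>UNIV. \<Sum>y\<in>UNIV. w x y * b $ x $ y * (g y - g x))
    = - 2 * (\<Sum>x\<in>UNIV. \<mu> x * g x * coboundary_adjoint w \<mu> b x)"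
proof -
  have 1: "(\<Sum>x\<in>UNIV. \<Sum>y\<in>UNIV. w x y * b $ x $ y * g x)
      = (\<Sum>x\<in>UNIV. \<mu> x * g x * coboundary_adjoint w \<mu> b x)"
    unfolding coboundary_adjoint_def sum_distrib_left
    by (intro sum.cong) (auto simp: less_imp_neq[symmetric] \<mu>_pos[THEN less_imp_neq, symmetric])
  have "(\<Sum>x\<in>UNIV. \<Sum>y\<in>UNIV. w x y * b $ x $ y * g y)
      = (\<Sum>y\<in>UNIV. \<Sum>x\<in>UNIV. w x y * b $ x $ y * g y)"
    by (rule sum.swap)
  also have "\<dots> = - (\<Sum>y\<in>UNIV. \<Sum>x\<in>UNIV. w y x * b $ y $ x * g y)"
    unfolding sum_negf[symmetric]
  proof (intro sum.cong refl)
    fix x y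
    show "w y x * b $ y $ x * g x = - (w x y * b $ x $ y * g x)"
      using w_sym[of x y] one_form_antisym[OF assms, of x y] by simp
  qed
  finally show ?thesis using 1 by (simp add: right_diff_distrib sum_subtractf)
qed

text \<open>Summation by parts with b = dh and g = h: the energy of h is a vanishing sum of
  nonnegative terms.\<close>

lemma harmonic_imp_dform_0:
  assumes "\<And>x. laplacian w \<mu> h x = 0"
  shows "dform w h = 0"
proof -
  have "(\<Sum>x\<in>UNIV. \<Sum>y\<in>UNIV. w x y * dform w h $ x $ y * (h y - h x)) = 0"
    using sum_form_dform[OF dform_one_form, of h h] assms by (simp add: coboundary_adjoint_dform)
  moreover have nn: "0 \<le> w x y * dform w h $ x $ y * (h y - h x)" for x y
    by (auto simp: dform_def mult.assoc)
  ultimately have "w x y * dform w h $ x $ y * (h y - h x) = 0" for x y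
    by (simp add: sum_nonneg_eq_0_iff sum_nonneg)
  then have "dform w h $ x $ y = 0" for x y
    by (cases "adj w x y") (force simp: dform_def adj_def)+
  then show ?thesis by (simp add: vec_eq_iff)
qed

lemma dform_subspace: "subspace (range (dform w))"
proof (rule subspaceI)
  show "0 \<in> range (dform w)"
    by (rule image_eqI[of _ _ "\<lambda>_. 0"]) (auto simp: dform_def vec_eq_iff)
  fix a b assume "a \<in> range (dform w)" "b \<in> range (dform w)"
  then obtain g h where "a = dform w g" "b = dform w h" by blast
  then show "a + b \<in> range (dform w)"
    by (intro image_eqI[of _ _ "\<lambda>x. g x + h x"]) (auto simp: dform_def vec_eq_iff)
next
  fix c :: real and a assume "a \<in> range (dform w)"
  then obtain g where "a = dform w g" by blast
  then show "c *\<^sub>R a \<in> range (dform w)"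
    by (intro image_eqI[of _ _ "\<lambda>x. c * g x"]) (auto simp: dform_def vec_eq_iff algebra_simps)
qed

text \<open>The forms \<alpha> + dh that obey the bound s make up a compact set: the cohomology
  class is a closed affine subspace, and the bound controls every entry. The assumption on
  \<open>h0\<close> makes the set nonempty.\<close>

lemma energy_minimizer_exists:
  assumes \<alpha>: "\<alpha> \<in> one_forms w" and K: "form_le w d s (\<alpha> + dform w h0)"
  obtains h where "form_le w d s (\<alpha> + dform w h)"
    "\<And>g. form_le w d s (\<alpha> + dform w g) \<Longrightarrow>
      (\<Sum>x\<in>UNIV. \<Sum>y\<in>UNIV. w x y * ((\<alpha> + dform w h) $ x $ y)\<^sup>2)
      \<le> (\<Sum>x\<in>UNIV. \<Sum>y\<in>UNIV. w x y * ((\<alpha> + dform w g) $ x $ y)\<^sup>2)"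
proof -
  define S where "S = {b. b - \<alpha> \<in> range (dform w)} \<inter> {b. form_le w d s b}"
  have in_S: "\<alpha> + dform w g \<in> S \<longleftrightarrow> form_le w d s (\<alpha> + dform w g)" for g
    by (simp add: S_def)
  have S_of: "b \<in> one_forms w" if b: "b \<in> S" for b
  proof -
    obtain g where "b - \<alpha> = dform w g" using b unfolding S_def by blast
    then have "b = \<alpha> + dform w g" by (simp add: algebra_simps)
    then show ?thesis using one_form_add[OF \<alpha> dform_one_form] by simp
  qed
  have "closed {b. b - \<alpha> \<in> range (dform w)}"
    using continuous_closed_vimage[OF closed_subspace[OF dform_subspace], of "\<lambda>b. b - \<alpha>"]
    by (simp add: vimage_def)
  moreover have "closed {b. form_le w d s b}"
    unfolding form_le_def
    by (intro closed_Collect_all closed_Collect_imp closed_Collect_le open_Collect_const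
        continuous_intros)
  ultimately have "closed S" unfolding S_def by (rule closed_Int)
  moreover have "bounded S"
  proof -
    have "norm b \<le> (\<Sum>x\<in>UNIV. \<Sum>y\<in>UNIV. \<bar>s\<bar> * d x y)" if b: "b \<in> S" for b
    proof -
      have of: "b \<in> one_forms w" using S_of[OF b] .
      have le: "form_le w d s b" using b by (simp add: S_def)
      have "\<bar>b $ x $ y\<bar> \<le> \<bar>s\<bar> * d x y" for x y
      proof (cases "adj w x y")
        case True
        then have "y \<in> nbh x" by simp
        from form_le_nbh[OF of le this] have "\<bar>b $ x $ y\<bar> \<le> s * d x y" by linarith
        also have "\<dots> \<le> \<bar>s\<bar> * d x y" by (intro mult_right_mono) auto
        finally show ?thesis .
      next
        case False
        then have "b $ x $ y = 0" using of unfolding one_forms_def by blast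
        then show ?thesis by simp
      qed
      then have "norm (b $ x) \<le> (\<Sum>y\<in>UNIV. \<bar>s\<bar> * d x y)" for x
        by (intro order_trans[OF norm_le_l1_cart] sum_mono) simp
      moreover have "norm b \<le> (\<Sum>x\<in>UNIV. norm (b $ x))"
        unfolding norm_vec_def by (rule L2_set_le_sum) simp
      ultimately show ?thesis by (meson order_trans sum_mono)
    qed
    then show ?thesis unfolding bounded_iff by blast
  qed
  ultimately have "compact S" by (simp add: compact_eq_bounded_closed)
  moreover have "S \<noteq> {}" using K in_S by blast
  moreover have "continuous_on S (\<lambda>b. \<Sum>x\<in>UNIV. \<Sum>y\<in>UNIV. w x y * (b $ x $ y)\<^sup>2)"
    by (intro continuous_intros)
  ultimately obtain b where b: "b \<in> S" "\<forall>b'\<in>S. (\<Sum>x\<in>UNIV. \<Sum>y\<in>UNIV. w x y * (b $ x $ y)\<^sup>2)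
      \<le> (\<Sum>x\<in>UNIV. \<Sum>y\<in>UNIV. w x y * (b' $ x $ y)\<^sup>2)"
    using continuous_attains_inf by blast
  obtain h where "b - \<alpha> = dform w h" using b(1) unfolding S_def by blast
  then have "b = \<alpha> + dform w h" by (simp add: algebra_simps)
  then show ?thesis using that b in_S by blast
qed

text \<open>Only the tight edges restrict the direction of a perturbation; the remaining finitely
  many edges have slack for a small multiple.\<close>

lemma form_le_add_dform:
  assumes le: "form_le w d s b" and c: "0 < c"
    and tight: "\<And>x y. adj w x y \<Longrightarrow> b $ x $ y = s * d x y \<Longrightarrow> g y \<le> g x"
  obtains \<epsilon> where "0 < \<epsilon>" "\<epsilon> < c" "form_le w d s (b + \<epsilon> *\<^sub>R dform w g)"
proof -
  let ?A = "{(x, y). adj w x y \<and> b $ x $ y < s * d x y}"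
  obtain \<epsilon> where \<epsilon>: "0 < \<epsilon>" "\<epsilon> < c"
    "\<And>e. e \<in> ?A \<Longrightarrow> \<epsilon> * (g (snd e) - g (fst e)) \<le> s * d (fst e) (snd e) - b $ fst e $ snd e"
    by (rule small_multiplier_exists[of ?A "\<lambda>e. s * d (fst e) (snd e) - b $ fst e $ snd e" c
          "\<lambda>e. g (snd e) - g (fst e)"]) (use c in auto)
  have "(b + \<epsilon> *\<^sub>R dform w g) $ x $ y \<le> s * d x y" if xy: "adj w x y" for x y
  proof (cases "b $ x $ y = s * d x y")
    case True
    then have "\<epsilon> * (g y - g x) \<le> 0" using tight[OF xy] \<epsilon>(1) by (simp add: mult_le_0_iff)
    then show ?thesis using True xy by (simp add: dform_def)
  next
    case False
    then have "(x, y) \<in> ?A" using le xy unfolding form_le_def by force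
    then show ?thesis using \<epsilon>(3)[of "(x, y)"] xy by (simp add: dform_def)
  qed
  then show ?thesis using that \<epsilon> by (simp add: form_le_def)
qed

end

section \<open>Monotone functions and tight cycles\<close>

locale harmonic_form = nonneg_curved_graph w \<mu> d
  for w :: "'v::finite \<Rightarrow> 'v \<Rightarrow> real" and \<mu> and d +
  fixes \<alpha> :: "real^'v^'v" and s :: real
  assumes harmonic: "\<alpha> \<in> H1 w \<mu> d" and s_pos: "0 < s" and form_le: "form_le w d s \<alpha>"
begin

definition tight :: "'v \<Rightarrow> 'v \<Rightarrow> bool" where
  "tight x y \<longleftrightarrow> adj w x y \<and> \<alpha> $ x $ y = s * d x y"

lemma \<alpha>_closed: "closed_form w d \<alpha>"
  and \<alpha>_coclosed [simp]: "coboundary_adjoint w \<mu> \<alpha> x = 0"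
  using harmonic by (auto simp: H1_def closed_form_def)

text \<open>Perturb \<alpha> to \<alpha> - \<epsilon> dh. Monotonicity preserves the bound s, and
  the edge stays tight as h is equal at its ends. Since \<alpha> is coclosed, comparing the adjoint
  coboundaries there compares the Laplacians of h.\<close>

lemma laplacian_le_of_monotone:
  assumes mono: "\<And>x y. tight x y \<Longrightarrow> h x \<le> h y" and xy: "tight x y" "h x = h y"
  shows "laplacian w \<mu> h x \<le> laplacian w \<mu> h y"
proof -
  obtain \<epsilon> where \<epsilon>: "0 < \<epsilon>" "form_le w d s (\<alpha> + \<epsilon> *\<^sub>R dform w (\<lambda>z. - h z))"
    by (rule form_le_add_dform[OF form_le, of 1 "\<lambda>z. - h z"]) (use mono in \<open>auto simp: tight_def\<close>)
  let ?b = "\<alpha> + \<epsilon> *\<^sub>R dform w (\<lambda>z. - h z)"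
  have "closed_form w d ?b"
    by (rule closed_form_add_scale[OF \<alpha>_closed closed_form_dform])
  moreover have "?b $ x $ y = s * d x y" "adj w x y"
    using xy by (auto simp: tight_def dform_def)
  ultimately have "coboundary_adjoint w \<mu> ?b y \<le> coboundary_adjoint w \<mu> ?b x"
    using coboundary_adjoint_le_of_tight[OF _ \<epsilon>(2)] s_pos by blast
  moreover have "coboundary_adjoint w \<mu> ?b z = - \<epsilon> * laplacian w \<mu> h z" for z
    using laplacian_scale[of "-1" h z]
    by (simp add: coboundary_adjoint_add coboundary_adjoint_scale coboundary_adjoint_dform)
  ultimately show ?thesis using \<epsilon>(1) by simp
qed

lemma monotone_rtranclp:
  assumes mono: "\<And>x y. tight x y \<Longrightarrow> h x \<le> (h y :: real)" and "tight\<^sup>*\<^sup>* x y"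
  shows "h x \<le> h y"
  using assms(2) by (induction rule: rtranclp_induct) (auto intro: order_trans mono)

text \<open>A monotone h is constant on a strongly connected component, so the comparison applies to
  each tight edge of a path inside it.\<close>

lemma laplacian_le_on_component:
  assumes mono: "\<And>x y. tight x y \<Longrightarrow> h x \<le> h y" and "tight\<^sup>*\<^sup>* x y" "tight\<^sup>*\<^sup>* y x"
  shows "laplacian w \<mu> h x \<le> laplacian w \<mu> h y"
  using assms(2,3)
proof (induction rule: rtranclp_induct)
  case (step y z)
  have "tight\<^sup>*\<^sup>* y x" using step.hyps(2) step.prems by (rule converse_rtranclp_into_rtranclp)
  then have "laplacian w \<mu> h x \<le> laplacian w \<mu> h y" by (rule step.IH)
  moreover have "h z \<le> h y"
    using monotone_rtranclp[of h z y, OF mono] step.prems step.hyps(1) by (auto intro: rtranclp_trans)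
  then have "h y = h z" using mono[OF step.hyps(2)] by simp
  then have "laplacian w \<mu> h y \<le> laplacian w \<mu> h z"
    using laplacian_le_of_monotone[of h, OF mono step.hyps(2)] by blast
  ultimately show ?case by linarith
qed simp

lemma laplacian_eq_on_component:
  assumes "\<And>x y. tight x y \<Longrightarrow> h x \<le> h y" and "tight\<^sup>*\<^sup>* x y" "tight\<^sup>*\<^sup>* y x"
  shows "laplacian w \<mu> h x = laplacian w \<mu> h y"
  using laplacian_le_on_component[of h, OF assms(1)] assms(2,3) by (meson antisym)

text \<open>
  The indicator of a vertex \<open>z\<close> off all tight cycles is the difference of the indicators of the
  two sets of vertices reachable from \<open>z\<close>, with and without \<open>z\<close>; both are monotone.
\<close>

lemma weight_eq_on_component:
  assumes z: "\<not> tight\<^sup>+\<^sup>+ z z" and xy: "tight\<^sup>*\<^sup>* x y" "tight\<^sup>*\<^sup>* y x" and ne: "x \<noteq> z" "y \<noteq> z"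
  shows "w x z / \<mu> x = w y z / \<mu> y"
proof -
  define h1 h2 :: "'v \<Rightarrow> real" where
    "h1 v = (if tight\<^sup>*\<^sup>* z v then 1 else 0)" and "h2 v = (if tight\<^sup>+\<^sup>+ z v then 1 else 0)" for v
  have mono1: "h1 a \<le> h1 b" if "tight a b" for a b
    using that by (auto simp: h1_def intro: rtranclp.rtrancl_into_rtrancl)
  have mono2: "h2 a \<le> h2 b" if "tight a b" for a b
    using that by (auto simp: h2_def intro: tranclp.trancl_into_trancl)
  have ind: "h1 v - h2 v = (if v = z then 1 else 0)" for v
    using z by (auto simp: h1_def h2_def dest: rtranclpD tranclp_into_rtranclp)
  have lap: "laplacian w \<mu> (\<lambda>v. h1 v - h2 v) a = w a z / \<mu> a" if "a \<noteq> z" for a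
    using that unfolding laplacian_def ind
    by (simp add: if_distrib[of "\<lambda>t. _ * t"] sum.delta cong: if_cong)
  have "laplacian w \<mu> (\<lambda>v. h1 v - h2 v) x = laplacian w \<mu> (\<lambda>v. h1 v - h2 v) y"
    unfolding laplacian_diff
    using laplacian_eq_on_component[of h1, OF mono1 xy] laplacian_eq_on_component[of h2, OF mono2 xy]
    by simp
  then show ?thesis using lap ne by simp
qed

lemma tight_cycle_neighbour:
  assumes x: "tight\<^sup>+\<^sup>+ x x" and xz: "adj w x z"
  shows "tight\<^sup>+\<^sup>+ z z"
proof (rule ccontr)
  assume z: "\<not> tight\<^sup>+\<^sup>+ z z"
  have ne: "v \<noteq> z" if "tight\<^sup>*\<^sup>* x v" "tight\<^sup>*\<^sup>* v x" for v
    using that x z by (metis rtranclp_tranclp_tranclp tranclp_rtranclp_tranclp)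
  have adj: "adj w v z" if v: "tight\<^sup>*\<^sup>* x v" "tight\<^sup>*\<^sup>* v x" for v
  proof -
    have "w x z / \<mu> x = w v z / \<mu> v"
      using weight_eq_on_component[OF z v] ne[OF v] ne[of x] by blast
    moreover have "0 < w x z / \<mu> x" using xz by (simp add: adj_def)
    ultimately show ?thesis using \<mu>_pos[of v] by (auto simp: adj_def zero_less_divide_iff)
  qed
  \<comment> \<open>Closedness on the triangle z, v, v' makes the increment equal to \<alpha>(v,
    v'), which is positive on a tight edge.\<close>
  have incr: "\<alpha> $ z $ v < \<alpha> $ z $ v'"
    if v: "tight v v'" "tight\<^sup>*\<^sup>* x v" "tight\<^sup>*\<^sup>* v' x" for v v'
  proof -
    have v': "tight\<^sup>*\<^sup>* x v'" "tight\<^sup>*\<^sup>* v x"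
      using v by (auto intro: rtranclp.rtrancl_into_rtrancl converse_rtranclp_into_rtranclp)
    have "[z, v, v'] \<in> X2 w d"
      using X2_triangle[of z v v'] adj v v' adj_sym tight_def by blast
    then have "\<alpha> $ z $ v + \<alpha> $ v $ v' + \<alpha> $ v' $ z = 0"
      using \<alpha>_closed by (auto simp: closed_form_def coboundary_eq_walk_length)
    moreover have "0 < \<alpha> $ v $ v'" using v(1) s_pos adj_d_pos by (simp add: tight_def)
    ultimately show ?thesis
      using one_form_antisym[OF closed_form_one_form[OF \<alpha>_closed], of v' z] by simp
  qed
  \<comment> \<open>Iterate the increments along the tight cycle; the premise keeps v in the
    component of x. Taking v = x gives the contradiction.\<close>
  have "tight\<^sup>*\<^sup>* v x \<longrightarrow> \<alpha> $ z $ x < \<alpha> $ z $ v" if "tight\<^sup>+\<^sup>+ x v" for v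
    using that
  proof (induction rule: tranclp_induct)
    case (base y)
    then show ?case using incr[of x y] by simp
  next
    case (step y y')
    then show ?case using incr[of y y']
      by (meson converse_rtranclp_into_rtranclp less_trans tranclp_into_rtranclp)
  qed
  then show False using x by blast
qed

text \<open>Two stages, by contradiction. If the tight edges are acyclic, adding a small
  differential pushes \<alpha> below a smaller bound s'. Among the forms of the class that obey s',
  the energy minimizer b turns out to be coclosed because of the curvature bound. Then b = \<alpha>,
  although \<alpha> exceeds s' d on the given tight edge.\<close>

lemma tight_cycle_exists:
  assumes ex: "tight x0 y0"
  shows "\<exists>x. tight\<^sup>+\<^sup>+ x x"
proof (rule ccontr)
  assume "\<not> ?thesis"
  then have acyclic: "\<not> tight\<^sup>+\<^sup>+ x x" for x by blast
  define D where "D = (\<Sum>x\<in>UNIV. \<Sum>y\<in>UNIV. d x y)"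
  have D: "d x y \<le> D" for x y
  proof -
    have "d x y \<le> (\<Sum>y\<in>UNIV. d x y)" by (rule member_le_sum) auto
    also have "\<dots> \<le> D"
      unfolding D_def by (rule member_le_sum[of x UNIV "\<lambda>x. sum (d x) UNIV"]) (auto intro: sum_nonneg)
    finally show ?thesis .
  qed
  \<comment> \<open>Without tight cycles the set of predecessors grows strictly along a tight edge,
    so h drops there by at least D, which dominates every distance.\<close>
  define h where "h v = - D * real (card {u. tight\<^sup>+\<^sup>+ u v})" for v
  have h: "h y - h x \<le> - d x y" if xy: "tight x y" for x y
  proof -
    have "{u. tight\<^sup>+\<^sup>+ u x} \<subset> {u. tight\<^sup>+\<^sup>+ u y}"
      using xy acyclic[of x] by (auto intro: tranclp.trancl_into_trancl)
    then have "card {u. tight\<^sup>+\<^sup>+ u x} < card {u. tight\<^sup>+\<^sup>+ u y}" by (intro psubset_card_mono) auto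
    then have "1 \<le> real (card {u. tight\<^sup>+\<^sup>+ u y}) - real (card {u. tight\<^sup>+\<^sup>+ u x})" by linarith
    from mult_left_mono[OF this, of D] D[of x y] d_nonneg[of x y] show ?thesis
      by (simp add: h_def algebra_simps)
  qed
  let ?A = "{(x, y). adj w x y \<and> \<alpha> $ x $ y < s * d x y}"
  obtain \<epsilon> where \<epsilon>: "0 < \<epsilon>" "\<epsilon> < s"
    "\<And>e. e \<in> ?A \<Longrightarrow> \<epsilon> * (h (snd e) - h (fst e) + d (fst e) (snd e)) \<le>
      s * d (fst e) (snd e) - \<alpha> $ fst e $ snd e"
    by (rule small_multiplier_exists[of ?A "\<lambda>e. s * d (fst e) (snd e) - \<alpha> $ fst e $ snd e" s
          "\<lambda>e. h (snd e) - h (fst e) + d (fst e) (snd e)"]) (use s_pos in auto)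
  define s' where "s' = s - \<epsilon>"
  have s': "0 < s'" "s' < s" using \<epsilon> by (auto simp: s'_def)
  have K: "form_le w d s' (\<alpha> + dform w (\<lambda>v. \<epsilon> * h v))"
    unfolding form_le_def
  proof (intro allI impI)
    fix x y assume xy: "adj w x y"
    have "\<alpha> $ x $ y + \<epsilon> * (h y - h x) \<le> s' * d x y"
    proof (cases "tight x y")
      case True
      from mult_left_mono[OF h[OF True], of \<epsilon>] show ?thesis
        using True \<epsilon>(1) by (simp add: tight_def s'_def algebra_simps)
    next
      case False
      then have "(x, y) \<in> ?A" using form_le xy unfolding form_le_def tight_def by force
      from \<epsilon>(3)[OF this] show ?thesis by (simp add: s'_def algebra_simps)
    qed
    then show "(\<alpha> + dform w (\<lambda>v. \<epsilon> * h v)) $ x $ y \<le> s' * d x y"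
      using xy by (simp add: dform_def algebra_simps)
  qed
  note \<alpha>_of = closed_form_one_form[OF \<alpha>_closed]
  obtain k where k: "form_le w d s' (\<alpha> + dform w k)"
    and min: "\<And>g. form_le w d s' (\<alpha> + dform w g) \<Longrightarrow>
      (\<Sum>x\<in>UNIV. \<Sum>y\<in>UNIV. w x y * ((\<alpha> + dform w k) $ x $ y)\<^sup>2)
      \<le> (\<Sum>x\<in>UNIV. \<Sum>y\<in>UNIV. w x y * ((\<alpha> + dform w g) $ x $ y)\<^sup>2)"
    using energy_minimizer_exists[OF \<alpha>_of K] by blast
  define b where "b = \<alpha> + dform w k"
  define g where "g = coboundary_adjoint w \<mu> b"
  have b_closed: "closed_form w d b"
    using closed_form_add_scale[OF \<alpha>_closed closed_form_dform, of 1 k] by (simp add: b_def)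
  note b_of = closed_form_one_form[OF b_closed]
  have b_le: "form_le w d s' b" using k by (simp add: b_def)
  \<comment> \<open>Curvature makes g, the adjoint coboundary of b, an admissible direction: g does
    not increase along edges where b attains s', so b + t dg still obeys s' for small t.\<close>
  have tight_b: "g y \<le> g x" if "adj w x y" "b $ x $ y = s' * d x y" for x y
    unfolding g_def by (rule coboundary_adjoint_le_of_tight[OF b_closed b_le that(1) s'(1) that(2)])
  define G where "G = (\<Sum>x\<in>UNIV. \<mu> x * g x * g x)"
  define E where "E = (\<Sum>x\<in>UNIV. \<Sum>y\<in>UNIV. w x y * (dform w g $ x $ y)\<^sup>2)"
  have E0: "0 \<le> E" unfolding E_def by (intro sum_nonneg) auto
  have G0: "0 \<le> G" unfolding G_def by (intro sum_nonneg) (auto simp: mult.assoc less_imp_le)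
  \<comment> \<open>In the energy of b + t dg the linear term is -4 t G by summation by parts and
    the quadratic one is t t E; minimality of b bounds their sum below by 0.\<close>
  have energy: "4 * G \<le> t * E" if t: "0 < t" "form_le w d s' (b + t *\<^sub>R dform w g)" for t
  proof -
    have eq: "b + t *\<^sub>R dform w g = \<alpha> + dform w (\<lambda>x. k x + t * g x)"
      by (auto simp: b_def dform_def vec_eq_iff algebra_simps)
    have "(\<Sum>x\<in>UNIV. \<Sum>y\<in>UNIV. w x y * (b $ x $ y)\<^sup>2)
        \<le> (\<Sum>x\<in>UNIV. \<Sum>y\<in>UNIV. w x y * ((b + t *\<^sub>R dform w g) $ x $ y)\<^sup>2)"
      unfolding eq using min t(2) unfolding b_def[symmetric] eq by blast
    also have "\<dots> = (\<Sum>x\<in>UNIV. \<Sum>y\<in>UNIV. w x y * (b $ x $ y)\<^sup>2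
        + 2 * t * (w x y * b $ x $ y * (g y - g x)) + t\<^sup>2 * (w x y * (dform w g $ x $ y)\<^sup>2))"
    proof (intro sum.cong refl)
      fix x y
      show "w x y * ((b + t *\<^sub>R dform w g) $ x $ y)\<^sup>2 = w x y * (b $ x $ y)\<^sup>2
        + 2 * t * (w x y * b $ x $ y * (g y - g x)) + t\<^sup>2 * (w x y * (dform w g $ x $ y)\<^sup>2)"
        by (cases "adj w x y") (auto simp: dform_def w_eq_0 power2_eq_square algebra_simps)
    qed
    also have "\<dots> = (\<Sum>x\<in>UNIV. \<Sum>y\<in>UNIV. w x y * (b $ x $ y)\<^sup>2) + 2 * t * (- 2 * G) + t\<^sup>2 * E"
      using sum_form_dform[OF b_of, of g]
      by (simp add: sum.distrib G_def E_def g_def flip: sum_distrib_left)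
    finally have "t * (4 * G) \<le> t * (t * E)" by (simp add: power2_eq_square algebra_simps)
    then show ?thesis using t(1) by simp
  qed
  have "G = 0"
  proof (rule ccontr)
    assume "G \<noteq> 0"
    \<comment> \<open>The added 1 covers E = 0.\<close>
    then have "0 < 4 * G / (E + 1)" using G0 E0 by simp
    from form_le_add_dform[of s' b _ g, OF b_le this tight_b] obtain t where
      t: "0 < t" "t < 4 * G / (E + 1)" "form_le w d s' (b + t *\<^sub>R dform w g)" by blast
    have "t * E \<le> t * (E + 1)" using t(1) by simp
    also have "\<dots> < 4 * G" using t(2) E0 by (simp add: pos_less_divide_eq)
    finally show False using energy[OF t(1,3)] by simp
  qed
  then have "\<mu> x * g x * g x = 0" for x
    unfolding G_def by (subst (asm) sum_nonneg_eq_0_iff) (auto simp: mult.assoc less_imp_le)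
  then have "g x = 0" for x using \<mu>_pos[of x] by (metis less_irrefl mult_eq_0_iff)
  then have "laplacian w \<mu> k x = 0" for x
    by (simp add: g_def b_def coboundary_adjoint_add coboundary_adjoint_dform)
  \<comment> \<open>Both b and \<alpha> are coclosed, so k is a harmonic function and dk =
    0.\<close>
  then have "b = \<alpha>" using harmonic_imp_dform_0[of k] by (simp add: b_def)
  then have "\<alpha> $ x0 $ y0 \<le> s' * d x0 y0" using b_le ex unfolding form_le_def tight_def by metis
  moreover have "s' * d x0 y0 < s * d x0 y0"
    using ex s'(2) adj_d_pos by (simp add: tight_def)
  ultimately show False using ex by (simp add: tight_def)
qed

lemma tight_cycle_everywhere:
  assumes "tight x0 y0"
  shows "tight\<^sup>+\<^sup>+ x x"
proof -
  obtain v where v: "tight\<^sup>+\<^sup>+ v v" using tight_cycle_exists[OF assms] by blast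
  show ?thesis
    using reachable[of v x] by (induction rule: rtranclp_induct) (auto intro: v tight_cycle_neighbour)
qed

lemma tight_out_edge:
  assumes "tight x0 y0"
  shows "\<exists>y. tight x y"
  using tight_cycle_everywhere[OF assms, of x] by (metis tranclpD)

end

section \<open>The dual unit ball of the harmonic forms\<close>

context metric_graph begin

section \<open>Harmonic forms and the functionals given by edges\<close>

lemma one_form_scale: "b \<in> one_forms w \<Longrightarrow> c *\<^sub>R b \<in> one_forms w"
proof -
  assume b: "b \<in> one_forms w"
  have "(c *\<^sub>R b) $ x $ y = - (c *\<^sub>R b) $ y $ x" for x y
    using one_form_antisym[OF b, of x y] by simp
  moreover have "(c *\<^sub>R b) $ x $ y = 0" if "\<not> adj w x y" for x y
    using b that unfolding one_forms_def by auto
  ultimately show ?thesis unfolding one_forms_def by blast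
qed

lemma H1_one_form: "\<alpha> \<in> H1 w \<mu> d \<Longrightarrow> \<alpha> \<in> one_forms w"
  by (simp add: H1_def)

lemma H1_closed_form: "\<alpha> \<in> H1 w \<mu> d \<Longrightarrow> closed_form w d \<alpha>"
  by (simp add: H1_def closed_form_def)

lemma H1_coclosed: "\<alpha> \<in> H1 w \<mu> d \<Longrightarrow> coboundary_adjoint w \<mu> \<alpha> x = 0"
  by (simp add: H1_def)

lemma subspace_H1: "subspace (H1 w \<mu> d)"
proof (rule subspaceI)
  have "(0::real^'v^'v) = 0 *\<^sub>R dform w (\<lambda>_. 0)" by simp
  then have "(0::real^'v^'v) \<in> one_forms w" using one_form_scale[OF dform_one_form] by metis
  then show "0 \<in> H1 w \<mu> d"
    by (simp add: H1_def coboundary_def coboundary_adjoint_def)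
next
  fix a b assume "a \<in> H1 w \<mu> d" "b \<in> H1 w \<mu> d"
  then show "a + b \<in> H1 w \<mu> d"
    using one_form_add by (simp add: H1_def coboundary_add coboundary_adjoint_add)
next
  fix c :: real and a assume "a \<in> H1 w \<mu> d"
  then show "c *\<^sub>R a \<in> H1 w \<mu> d"
    using one_form_scale by (simp add: H1_def coboundary_scale coboundary_adjoint_scale)
qed

lemma span_H1: "span (H1 w \<mu> d) = H1 w \<mu> d"
  using subspace_H1 by (simp add: span_eq_iff)

text \<open>Orthogonal projection of z to the harmonic forms. It represents functionals on
  \<open>H1\<close> by vectors of \<open>H1\<close> itself.\<close>

lemma H1_riesz:
  obtains a where "a \<in> H1 w \<mu> d" "\<And>\<alpha>. \<alpha> \<in> H1 w \<mu> d \<Longrightarrow> \<alpha> \<bullet> a = \<alpha> \<bullet> z"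
proof -
  obtain a b where ab: "a \<in> H1 w \<mu> d" "\<And>\<alpha>. \<alpha> \<in> H1 w \<mu> d \<Longrightarrow> orthogonal b \<alpha>" "z = a + b"
    using orthogonal_subspace_decomp_exists[of "H1 w \<mu> d" z] unfolding span_H1 by metis
  have "\<alpha> \<bullet> a = \<alpha> \<bullet> z" if "\<alpha> \<in> H1 w \<mu> d" for \<alpha>
    using ab(2)[OF that] ab(3) by (simp add: inner_add_right orthogonal_def inner_commute)
  then show ?thesis using that ab(1) by blast
qed

text \<open>A Riesz representative inside \<open>H1\<close>; by \<open>H1_eqI\<close> there is only
  one, so the choice is harmless. The dual space is thus identified with \<open>H1\<close>, and
  convex geometry can be done there.\<close>

definition slope_vec :: "'v \<Rightarrow> 'v \<Rightarrow> real^'v^'v" where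
  "slope_vec x y =
    (SOME a. a \<in> H1 w \<mu> d \<and> (\<forall>\<alpha>\<in>H1 w \<mu> d. \<alpha> \<bullet> a = \<alpha> $ x $ y / d x y))"

lemma slope_vec_H1: "slope_vec x y \<in> H1 w \<mu> d"
  and inner_slope_vec: "\<alpha> \<in> H1 w \<mu> d \<Longrightarrow> \<alpha> \<bullet> slope_vec x y = \<alpha> $ x $ y / d x y"
proof -
  obtain a where a: "a \<in> H1 w \<mu> d"
    "\<And>\<alpha>. \<alpha> \<in> H1 w \<mu> d \<Longrightarrow> \<alpha> \<bullet> a = \<alpha> \<bullet> axis x (axis y (1 / d x y))"
    using H1_riesz by blast
  have "\<exists>a. a \<in> H1 w \<mu> d \<and> (\<forall>\<alpha>\<in>H1 w \<mu> d. \<alpha> \<bullet> a = \<alpha> $ x $ y / d x y)"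
    using a by (auto simp: inner_axis)
  then have "slope_vec x y \<in> H1 w \<mu> d \<and>
      (\<forall>\<alpha>\<in>H1 w \<mu> d. \<alpha> \<bullet> slope_vec x y = \<alpha> $ x $ y / d x y)"
    unfolding slope_vec_def by (rule someI_ex)
  then show "slope_vec x y \<in> H1 w \<mu> d"
    "\<alpha> \<in> H1 w \<mu> d \<Longrightarrow> \<alpha> \<bullet> slope_vec x y = \<alpha> $ x $ y / d x y" by blast+
qed

lemma H1_eqI:
  assumes "a \<in> H1 w \<mu> d" "b \<in> H1 w \<mu> d" "\<And>\<alpha>. \<alpha> \<in> H1 w \<mu> d \<Longrightarrow> \<alpha> \<bullet> a = \<alpha> \<bullet> b"
  shows "a = b"
proof -
  have "a - b \<in> H1 w \<mu> d" using subspace_diff[OF subspace_H1 assms(1,2)] .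
  then have "(a - b) \<bullet> (a - b) = 0" using assms(3)[of "a - b"] by (simp add: inner_diff_right)
  then show ?thesis by simp
qed

lemma slope_vec_antisym: "slope_vec y x = - slope_vec x y"
proof (rule H1_eqI[OF slope_vec_H1 subspace_neg[OF subspace_H1 slope_vec_H1]])
  fix \<alpha> assume \<alpha>: "\<alpha> \<in> H1 w \<mu> d"
  then show "\<alpha> \<bullet> slope_vec y x = \<alpha> \<bullet> - slope_vec x y"
    using one_form_antisym[OF H1_one_form[OF \<alpha>], of x y] d_sym[of x y]
    by (simp add: inner_slope_vec)
qed

text \<open>Once the graph has an edge, this is the unit ball of the norm dual to the sup norm on
  harmonic forms. Quantifying over all bounds s avoids naming the sup norm.\<close>

definition dual_ball :: "(real^'v^'v) set" where
  "dual_ball = {p \<in> H1 w \<mu> d. \<forall>\<alpha>\<in>H1 w \<mu> d. \<forall>s. form_le w d s \<alpha> \<longrightarrow> \<alpha> \<bullet> p \<le> s}"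

lemma form_le_uminus:
  assumes "\<alpha> \<in> one_forms w" "form_le w d s \<alpha>"
  shows "form_le w d s (- \<alpha>)"
  unfolding form_le_def
proof (intro allI impI)
  fix x y assume "adj w x y"
  then have "y \<in> nbh x" by simp
  from form_le_nbh(2)[OF assms this] show "(- \<alpha>) $ x $ y \<le> s * d x y" by simp
qed

lemma dual_ball_uminus: "p \<in> dual_ball \<Longrightarrow> - p \<in> dual_ball"
proof -
  assume p: "p \<in> dual_ball"
  have "\<alpha> \<bullet> - p \<le> s" if \<alpha>: "\<alpha> \<in> H1 w \<mu> d" "form_le w d s \<alpha>" for \<alpha> s
  proof -
    have "- \<alpha> \<in> H1 w \<mu> d" using subspace_neg[OF subspace_H1 \<alpha>(1)] .
    moreover have "form_le w d s (- \<alpha>)" using form_le_uminus[OF H1_one_form[OF \<alpha>(1)] \<alpha>(2)] .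
    ultimately have "- \<alpha> \<bullet> p \<le> s" using p unfolding dual_ball_def by blast
    then show ?thesis by simp
  qed
  then show ?thesis using p subspace_neg[OF subspace_H1] unfolding dual_ball_def by blast
qed

lemma slope_vec_dual_ball:
  assumes "adj w x y"
  shows "slope_vec x y \<in> dual_ball"
  unfolding dual_ball_def
proof (intro CollectI conjI slope_vec_H1 ballI allI impI)
  fix \<alpha> s assume "\<alpha> \<in> H1 w \<mu> d" "form_le w d s \<alpha>"
  then show "\<alpha> \<bullet> slope_vec x y \<le> s"
    using assms adj_d_pos[OF assms] by (simp add: inner_slope_vec form_le_def pos_divide_le_eq)
qed

lemma convex_dual_ball: "convex dual_ball"
proof -
  have "dual_ball = H1 w \<mu> d \<inter> (\<Inter>\<alpha>\<in>H1 w \<mu> d. \<Inter>s\<in>{s. form_le w d s \<alpha>}. {p. \<alpha> \<bullet> p \<le> s})"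
    unfolding dual_ball_def by blast
  also have "convex \<dots>"
    by (intro convex_Int convex_INT subspace_imp_convex[OF subspace_H1] convex_halfspace_le)
  finally show ?thesis .
qed

end

lemma neq_uminus_self:
  fixes e :: "'a::real_vector"
  assumes "e \<noteq> 0"
  shows "e \<noteq> - e"
proof
  assume "e = - e"
  then have "2 *\<^sub>R e = 0" by (metis add.right_inverse scaleR_2)
  then show False using assms by simp
qed

lemma extreme_point_of_uminus:
  fixes S :: "'a::real_vector set"
  assumes "p extreme_point_of S" "\<And>q. q \<in> S \<Longrightarrow> - q \<in> S"
  shows "- p extreme_point_of S"
  unfolding extreme_point_of_def
proof (intro conjI ballI notI)
  show "- p \<in> S" using assms by (simp add: extreme_point_of_def)
  fix a b assume ab: "a \<in> S" "b \<in> S" "- p \<in> open_segment a b"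
  then obtain u where u: "a \<noteq> b" "0 < u" "u < 1" "- p = (1 - u) *\<^sub>R a + u *\<^sub>R b"
    by (auto simp: in_segment)
  then have "p = (1 - u) *\<^sub>R (- a) + u *\<^sub>R (- b)"
    by (metis minus_add_distrib minus_minus scaleR_minus_right)
  then have "p \<in> open_segment (- a) (- b)" using u by (auto simp: in_segment)
  then show False using assms ab by (auto simp: extreme_point_of_def)
qed

section \<open>Extreme directions and the degree bound\<close>

context nonneg_curved_graph begin

text \<open>Let s be the largest slope of \<alpha> over all edges. Some edge is then tight, so tight
  cycles pass through every vertex: the sup norm is attained at each vertex.\<close>

lemma harmonic_form_tight_everywhere:
  assumes \<alpha>: "\<alpha> \<in> H1 w \<mu> d" "\<alpha> \<noteq> 0"
  obtains s where "0 < s" "form_le w d s \<alpha>" "\<And>x. \<exists>y. adj w x y \<and> \<alpha> $ x $ y = s * d x y"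
proof -
  note of = H1_one_form[OF \<alpha>(1)]
  let ?S = "(\<lambda>(x, y). \<alpha> $ x $ y / d x y) ` {(x, y). adj w x y}"
  obtain a b where "\<alpha> $ a $ b \<noteq> 0" using \<alpha>(2) by (metis vec_eq_iff zero_index)
  then have "0 < \<alpha> $ a $ b \<or> 0 < \<alpha> $ b $ a"
    using one_form_antisym[OF of, of a b] by linarith
  then obtain a b where "0 < \<alpha> $ a $ b" by blast
  moreover from this have ab: "adj w a b" using of unfolding one_forms_def by fastforce
  ultimately have pos: "0 < \<alpha> $ a $ b / d a b" using adj_d_pos by simp
  have fin: "finite ?S" by simp
  have ne: "?S \<noteq> {}" using ab by auto
  define s where "s = Max ?S"
  have "\<alpha> $ a $ b / d a b \<le> s" unfolding s_def using ab by (intro Max_ge fin) auto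
  then have s: "0 < s" using pos by linarith
  have le: "form_le w d s \<alpha>"
    unfolding form_le_def
  proof (intro allI impI)
    fix x y assume xy: "adj w x y"
    then have "\<alpha> $ x $ y / d x y \<le> s" unfolding s_def by (intro Max_ge fin) auto
    then show "\<alpha> $ x $ y \<le> s * d x y" using adj_d_pos[OF xy] by (simp add: pos_divide_le_eq)
  qed
  have "s \<in> ?S" unfolding s_def by (rule Max_in[OF fin ne])
  then obtain x0 y0 where x0: "adj w x0 y0" "s = \<alpha> $ x0 $ y0 / d x0 y0" by auto
  interpret hf: harmonic_form w \<mu> d \<alpha> s
    by unfold_locales (use \<alpha> s le in auto)
  have "hf.tight x0 y0" unfolding hf.tight_def using x0 adj_d_pos[OF x0(1)] by auto
  then have "\<exists>y. adj w x y \<and> \<alpha> $ x $ y = s * d x y" for x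
    using hf.tight_out_edge[of x0 y0 x] unfolding hf.tight_def by blast
  then show ?thesis using that s le by blast
qed

text \<open>A point of the ball outside the hull would be separated from it by a harmonic form whose
  norm is not attained at x. As x is arbitrary, all vertices share one and the same hull.\<close>

lemma dual_ball_eq_hull:
  assumes nz: "\<alpha>0 \<in> H1 w \<mu> d" "\<alpha>0 \<noteq> 0"
  shows "dual_ball = convex hull (slope_vec x ` {y. adj w x y})"
proof (rule antisym)
  let ?K = "convex hull (slope_vec x ` {y. adj w x y})"
  show "?K \<subseteq> dual_ball"
    by (rule hull_minimal) (use slope_vec_dual_ball convex_dual_ball in auto)
  show "dual_ball \<subseteq> ?K"
  proof (rule ccontr)
    assume "\<not> dual_ball \<subseteq> ?K"
    then obtain p where p: "p \<in> dual_ball" "p \<notin> ?K" by blast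
    have "compact ?K" by (intro finite_imp_compact_convex_hull) simp
    then have cl: "closed ?K" by (rule compact_imp_closed)
    obtain y0 where "adj w x y0"
      using harmonic_form_tight_everywhere[OF nz] by metis
    then have "slope_vec x y0 \<in> ?K" by (intro hull_inc) auto
    then have ne: "?K \<noteq> {}" by blast
    \<comment> \<open>This form of separation supplies a normal a - p with a in the hull; as p and a
      are harmonic, so is the normal.\<close>
    obtain a b where ab: "a \<in> ?K" "(a - p) \<bullet> p < b" "\<And>z. z \<in> ?K \<Longrightarrow> b < (a - p) \<bullet> z"
      using separating_hyperplane_closed_point_inset[OF convex_convex_hull cl ne p(2)] by metis
    have "?K \<subseteq> H1 w \<mu> d"
      by (intro hull_minimal subspace_imp_convex[OF subspace_H1]) (auto simp: slope_vec_H1)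
    then have "a \<in> H1 w \<mu> d" using ab(1) by blast
    then have \<beta>: "p - a \<in> H1 w \<mu> d"
      using p(1) subspace_diff[OF subspace_H1] by (simp add: dual_ball_def)
    have "p - a \<noteq> 0" using ab(1) p(2) by auto
    from harmonic_form_tight_everywhere[OF \<beta> this] obtain s where
      s: "form_le w d s (p - a)" "\<And>x. \<exists>y. adj w x y \<and> (p - a) $ x $ y = s * d x y" by metis
    obtain y where y: "adj w x y" "(p - a) $ x $ y = s * d x y" using s(2) by blast
    have "slope_vec x y \<in> ?K" using y(1) by (intro hull_inc) auto
    from ab(3)[OF this] have "(p - a) \<bullet> slope_vec x y < - b" by (simp add: inner_diff_left)
    moreover have "(p - a) \<bullet> slope_vec x y = s"
      using y adj_d_pos[OF y(1)] unfolding inner_slope_vec[OF \<beta>] by auto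
    moreover have "- b < (p - a) \<bullet> p" using ab(2) by (simp add: inner_diff_left)
    moreover have "(p - a) \<bullet> p \<le> s" using p(1) \<beta> s(1) unfolding dual_ball_def by blast
    ultimately show False by linarith
  qed
qed

text \<open>The extreme points of the ball occur among the slope vectors of every vertex. They span
  \<open>H1\<close>: a nonzero harmonic form orthogonal to them would vanish on all slope vectors
  although it is tight on some edge. By symmetry of the ball they come in antipodal pairs, so a
  basis chosen among them brings its negatives along.\<close>

lemma slope_vec_basis:
  assumes betti: "1 \<le> betti1 w \<mu> d"
  obtains B where "independent B" "card B = betti1 w \<mu> d" "span B = H1 w \<mu> d"
    "B \<inter> uminus ` B = {}" "\<And>x. B \<union> uminus ` B \<subseteq> slope_vec x ` {y. adj w x y}"
proof -
  have "H1 w \<mu> d \<noteq> {0}"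
  proof
    assume "H1 w \<mu> d = {0}"
    moreover have "dim {0::real^'v^'v} = 0" by (simp only: dim_eq_0)
    ultimately show False using betti by (simp add: betti1_def)
  qed
  then obtain \<alpha>0 where nz: "\<alpha>0 \<in> H1 w \<mu> d" "\<alpha>0 \<noteq> 0"
    using subspace_0[OF subspace_H1] by blast
  note hull = dual_ball_eq_hull[OF nz]
  define X where "X = {e. e extreme_point_of dual_ball}"
  have X_sub: "X \<subseteq> slope_vec x ` {y. adj w x y}" for x
    unfolding X_def hull[of x] by (rule extreme_points_of_convex_hull)
  have hull_X: "dual_ball = convex hull X"
    unfolding X_def using Krein_Milman_polytope[of "slope_vec undefined ` {y. adj w undefined y}"]
    unfolding hull[of undefined, symmetric] by simp
  have X_H1: "X \<subseteq> H1 w \<mu> d" using X_sub[of undefined] slope_vec_H1 by blast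
  have "span X = H1 w \<mu> d"
  proof (rule ccontr)
    assume "span X \<noteq> H1 w \<mu> d"
    moreover have sub: "span X \<subseteq> H1 w \<mu> d" using X_H1 span_mono span_H1 by metis
    ultimately have "span X \<subset> span (H1 w \<mu> d)" using span_H1 by blast
    from orthogonal_to_subspace_exists_gen[OF this] obtain \<alpha> where
      \<alpha>: "\<alpha> \<noteq> 0" "\<alpha> \<in> H1 w \<mu> d" "\<And>y. y \<in> span X \<Longrightarrow> orthogonal \<alpha> y"
      using span_H1 by metis
    obtain s where s: "0 < s" "\<And>x. \<exists>y. adj w x y \<and> \<alpha> $ x $ y = s * d x y"
      using harmonic_form_tight_everywhere[OF \<alpha>(2,1)] by metis
    obtain x y where xy: "adj w x y" "\<alpha> $ x $ y = s * d x y" using s(2) by blast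
    have "slope_vec x y \<in> convex hull X"
      using slope_vec_dual_ball[OF xy(1)] hull_X by simp
    then have "slope_vec x y \<in> span X" using convex_hull_subset_span by blast
    then have "\<alpha> \<bullet> slope_vec x y = 0" using \<alpha>(3) by (simp add: orthogonal_def)
    then show False using xy s(1) adj_d_pos[OF xy(1)] unfolding inner_slope_vec[OF \<alpha>(2)]
      by (auto split: if_splits)
  qed
  have X_uminus: "- e \<in> X" if "e \<in> X" for e
    using that extreme_point_of_uminus[OF _ dual_ball_uminus] by (simp add: X_def)
  \<comment> \<open>Zero is the midpoint of e and -e, so it could be extreme only if every extreme
    point were 0.\<close>
  have X0: "0 \<notin> X"
  proof
    assume "0 \<in> X"
    have "e = 0" if e: "e \<in> X" for e
    proof (rule ccontr)
      assume "e \<noteq> 0"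
      then have "e \<noteq> - e" by (rule neq_uminus_self)
      moreover have "\<exists>t. 0 < t \<and> t < 1 \<and> 0 = (1 - t) *\<^sub>R e + t *\<^sub>R - e"
        by (intro exI[of _ "1/2"]) simp
      ultimately have "0 \<in> open_segment e (- e)" unfolding in_segment by blast
      moreover have "e \<in> dual_ball" "- e \<in> dual_ball"
        using e X_uminus[OF e] by (auto simp: X_def extreme_point_of_def)
      ultimately show False using \<open>0 \<in> X\<close> by (auto simp: X_def extreme_point_of_def)
    qed
    then have "span X \<subseteq> {0}" using span_mono[of X "{0}"] by auto
    then show False using \<open>span X = H1 w \<mu> d\<close> nz by blast
  qed
  obtain B where B: "B \<subseteq> X" "independent B" "X \<subseteq> span B" "card B = dim X"
    by (rule basis_exists)
  show ?thesis
  proof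
    show "independent B" by fact
    show "span B = H1 w \<mu> d"
      using B(1,3) \<open>span X = H1 w \<mu> d\<close> by (metis span_mono span_span subset_antisym)
    show "card B = betti1 w \<mu> d"
      unfolding betti1_def using B(4) \<open>span X = H1 w \<mu> d\<close> dim_span by metis
    show "B \<inter> uminus ` B = {}"
    proof (rule ccontr)
      assume "B \<inter> uminus ` B \<noteq> {}"
      then obtain e where e: "e \<in> B" "- e \<in> B" by auto
      have "e \<noteq> 0" using e B(1) X0 by blast
      then have "- e \<noteq> e" using neq_uminus_self[of e] by metis
      then have "e \<in> B - {- e}" using e(1) by auto
      then have "- e \<in> span (B - {- e})" by (intro span_neg span_base)
      then show False using B(2) e(2) unfolding dependent_def by blast
    qed
    show "B \<union> uminus ` B \<subseteq> slope_vec x ` {y. adj w x y}" for x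
      using B(1) X_uminus X_sub[of x] by blast
  qed
qed

lemma vertex_degree_ge:
  assumes "1 \<le> betti1 w \<mu> d"
  shows "2 * betti1 w \<mu> d \<le> vertex_degree w x"
proof -
  obtain B where B: "independent B" "card B = betti1 w \<mu> d"
    "B \<inter> uminus ` B = {}" "\<And>x. B \<union> uminus ` B \<subseteq> slope_vec x ` {y. adj w x y}"
    using slope_vec_basis[OF assms] by metis
  have "card (B \<union> uminus ` B) = 2 * betti1 w \<mu> d"
    using B(2,3) independent_imp_finite[OF B(1)] card_image[of uminus B]
    by (simp add: card_Un_disjoint)
  moreover have "card (B \<union> uminus ` B) \<le> card (slope_vec x ` {y. adj w x y})"
    by (intro card_mono B(4)) simp
  moreover have "\<dots> \<le> card {y. adj w x y}" by (rule card_image_le) simp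
  moreover have "{y. adj w x y} = {y. adj w y x}" using adj_sym by blast
  ultimately show ?thesis by (simp add: vertex_degree_def)
qed

end

section \<open>Directions and their commutation\<close>

text \<open>The equality case of the degree bound, where every vertex has exactly one neighbour in
  each direction of B and -B.\<close>

locale flat_graph = nonneg_curved_graph w \<mu> d
  for w :: "'v::finite \<Rightarrow> 'v \<Rightarrow> real" and \<mu> and d +
  fixes B :: "(real^'v^'v) set"
  assumes indep_B: "independent B" and span_B: "span B = H1 w \<mu> d"
    and disj_B: "B \<inter> uminus ` B = {}"
    and bij_slope_vec: "\<And>x. bij_betw (slope_vec x) {y. adj w x y} (B \<union> uminus ` B)"
begin

definition dirs :: "(real^'v^'v) set" where "dirs = B \<union> uminus ` B"

definition act :: "real^'v^'v \<Rightarrow> 'v \<Rightarrow> 'v" where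
  "act e x = (THE y. adj w x y \<and> slope_vec x y = e)"

lemma dirs_uminus [simp]: "e \<in> dirs \<Longrightarrow> - e \<in> dirs"
  by (auto simp: dirs_def)

lemma slope_vec_inj: "adj w x y \<Longrightarrow> adj w x z \<Longrightarrow> slope_vec x y = slope_vec x z \<Longrightarrow> y = z"
  using bij_slope_vec[of x] unfolding bij_betw_def inj_on_def by blast

lemma slope_vec_dirs: "adj w x y \<Longrightarrow> slope_vec x y \<in> dirs"
  using bij_slope_vec[of x] unfolding bij_betw_def dirs_def by blast

lemma act_eq: "adj w x y \<Longrightarrow> slope_vec x y = e \<Longrightarrow> act e x = y"
  unfolding act_def using slope_vec_inj by blast

lemma act_adj [simp]: "e \<in> dirs \<Longrightarrow> adj w x (act e x)"
  and slope_vec_act [simp]: "e \<in> dirs \<Longrightarrow> slope_vec x (act e x) = e"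
proof -
  assume "e \<in> dirs"
  then have "e \<in> slope_vec x ` {y. adj w x y}"
    using bij_slope_vec[of x] unfolding bij_betw_def dirs_def by blast
  then obtain y where "adj w x y" "slope_vec x y = e" by blast
  then show "adj w x (act e x)" "slope_vec x (act e x) = e" using act_eq by auto
qed

lemma adj_iff_act: "adj w x y \<longleftrightarrow> (\<exists>e\<in>dirs. y = act e x)"
  using act_eq slope_vec_dirs act_adj by metis

lemma act_inj_dir: "e \<in> dirs \<Longrightarrow> e' \<in> dirs \<Longrightarrow> act e x = act e' x \<Longrightarrow> e = e'"
  using slope_vec_act by metis

lemma act_uminus_act [simp]: "e \<in> dirs \<Longrightarrow> act (- e) (act e x) = x"
proof (rule act_eq)
  assume e: "e \<in> dirs"
  show "adj w (act e x) x" using act_adj[OF e] adj_sym by blast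
  show "slope_vec (act e x) x = - e" using slope_vec_antisym[of "act e x" x] e by simp
qed

lemma act_act_uminus [simp]: "e \<in> dirs \<Longrightarrow> act e (act (- e) x) = x"
  using act_uminus_act[of "- e" x] by simp

lemma inj_act: "e \<in> dirs \<Longrightarrow> inj (act e)"
  by (rule inj_on_inverseI[of _ "act (- e)"]) simp

text \<open>The basis dual to B, realised by harmonic forms; a direction in -B takes the negated
  form.\<close>

lemma dual_form_exists:
  assumes "e \<in> dirs"
  shows "\<exists>\<xi>. \<xi> \<in> H1 w \<mu> d \<and> \<xi> \<bullet> e = 1 \<and> (\<forall>e'\<in>dirs. e' \<noteq> e \<longrightarrow> e' \<noteq> - e \<longrightarrow> \<xi> \<bullet> e' = 0)"
proof -
  have B: "\<exists>\<xi>. \<xi> \<in> H1 w \<mu> d \<and> \<xi> \<bullet> b = 1 \<and> (\<forall>e'\<in>dirs. e' \<noteq> b \<longrightarrow> e' \<noteq> - b \<longrightarrow> \<xi> \<bullet> e' = 0)"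
    if b: "b \<in> B" for b
  proof -
    obtain g :: "real^'v^'v \<Rightarrow> real" where g: "linear g" "\<forall>x\<in>B. g x = (if x = b then 1 else 0)"
      using linear_independent_extend[OF indep_B, of "\<lambda>x. if x = b then 1 else 0"] by blast
    \<comment> \<open>\<open>adjoint g 1\<close> represents the coordinate functional g; its
      harmonic part does so on B.\<close>
    obtain a where a: "a \<in> H1 w \<mu> d" "\<And>\<alpha>. \<alpha> \<in> H1 w \<mu> d \<Longrightarrow> \<alpha> \<bullet> a = \<alpha> \<bullet> adjoint g 1"
      using H1_riesz by blast
    have ag: "a \<bullet> x = g x" if "x \<in> B" for x
      using a(2)[of x] that span_B span_base[of x B] adjoint_works[OF g(1), of x 1]
      by (simp add: inner_commute)
    have "a \<bullet> e' = 0" if e': "e' \<in> dirs" "e' \<noteq> b" "e' \<noteq> - b" for e'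
    proof (cases "e' \<in> B")
      case True
      then show ?thesis using ag g(2) e' by simp
    next
      case False
      then have "- e' \<in> B" using e'(1) by (auto simp: dirs_def)
      moreover have "- e' \<noteq> b" using e'(3) by auto
      ultimately have "a \<bullet> - e' = 0" using ag[of "- e'"] g(2) by metis
      then show ?thesis by simp
    qed
    then show ?thesis using a(1) ag[OF b] g(2) b by (intro exI[of _ a]) simp
  qed
  show ?thesis
  proof (cases "e \<in> B")
    case True
    then show ?thesis by (rule B)
  next
    case False
    then have "- e \<in> B" using assms by (auto simp: dirs_def)
    from B[OF this] obtain \<xi> where \<xi>: "\<xi> \<in> H1 w \<mu> d" "\<xi> \<bullet> - e = 1"
      "\<forall>e'\<in>dirs. e' \<noteq> - e \<longrightarrow> e' \<noteq> e \<longrightarrow> \<xi> \<bullet> e' = 0" by auto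
    show ?thesis
      using \<xi> subspace_neg[OF subspace_H1 \<xi>(1)] by (intro exI[of _ "- \<xi>"]) auto
  qed
qed

definition dual_form :: "real^'v^'v \<Rightarrow> real^'v^'v" where
  "dual_form e = (SOME \<xi>. \<xi> \<in> H1 w \<mu> d \<and> \<xi> \<bullet> e = 1 \<and>
    (\<forall>e'\<in>dirs. e' \<noteq> e \<longrightarrow> e' \<noteq> - e \<longrightarrow> \<xi> \<bullet> e' = 0))"

lemma dual_form:
  assumes "e \<in> dirs"
  shows "dual_form e \<in> H1 w \<mu> d" "dual_form e \<bullet> e = 1"
    "\<And>e'. e' \<in> dirs \<Longrightarrow> e' \<noteq> e \<Longrightarrow> e' \<noteq> - e \<Longrightarrow> dual_form e \<bullet> e' = 0"
  using someI_ex[OF dual_form_exists[OF assms], folded dual_form_def] by auto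

lemma harmonic_on_edge:
  assumes "\<alpha> \<in> H1 w \<mu> d" "adj w x y"
  shows "\<alpha> $ x $ y = (\<alpha> \<bullet> slope_vec x y) * d x y"
  using inner_slope_vec[OF assms(1), of x y] adj_d_pos[OF assms(2)] by auto

lemma dual_form_act:
  assumes "e \<in> dirs" "e' \<in> dirs"
  shows "dual_form e $ x $ act e' x = (dual_form e \<bullet> e') * d x (act e' x)"
  using harmonic_on_edge[OF dual_form(1)[OF assms(1)] act_adj[OF assms(2)]] assms(2) by simp

text \<open>In every direction other than e the form has slope 0 or -1. A positive value therefore
  identifies the vertex; the arguments below locate vertices in this way.\<close>

lemma dual_form_pos:
  assumes "e \<in> dirs" "y \<in> nbh x" "0 < dual_form e $ x $ y"
  shows "y = act e x"
proof -
  have "y \<noteq> x" using assms(3) one_form_diag[OF H1_one_form[OF dual_form(1)[OF assms(1)]], of x] by auto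
  then have xy: "adj w x y" using assms(2) by auto
  then obtain e' where e': "e' \<in> dirs" "y = act e' x" using adj_iff_act by blast
  have "0 < dual_form e \<bullet> e'"
    using assms(3) dual_form_act[OF assms(1) e'(1), of x] adj_d_pos[OF xy] e'(2)
    by (simp add: zero_less_mult_iff)
  moreover have "dual_form e \<bullet> - e = -1" using dual_form(2)[OF assms(1)] by simp
  ultimately have "e' = e" using dual_form(3)[OF assms(1) e'(1)] by fastforce
  then show ?thesis using e'(2) by simp
qed

text \<open>The two forms are nonzero on disjoint sets of edges, so adding a multiple with |t| \<le>
  1 keeps the norm at most 1. Freedom in both signs of t later turns inequalities into
  equalities.\<close>

lemma form_le_dual_forms:
  assumes e: "e \<in> dirs" "e' \<in> dirs" "e' \<noteq> e" "e' \<noteq> - e" and t: "\<bar>t\<bar> \<le> 1"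
  shows "closed_form w d (dual_form e + t *\<^sub>R dual_form e')"
    and "form_le w d 1 (dual_form e + t *\<^sub>R dual_form e')"
proof -
  show "closed_form w d (dual_form e + t *\<^sub>R dual_form e')"
    using closed_form_add_scale H1_closed_form dual_form(1) e by blast
  have H: "dual_form e + t *\<^sub>R dual_form e' \<in> H1 w \<mu> d"
    using subspace_add[OF subspace_H1] subspace_scale[OF subspace_H1] dual_form(1) e by blast
  have "(dual_form e + t *\<^sub>R dual_form e') \<bullet> f \<le> 1" if f: "f \<in> dirs" for f
  proof -
    have [simp]: "dual_form e \<bullet> e' = 0" using dual_form(3)[OF e(1,2)] e by blast
    have "e \<noteq> - e'" using e(4) by auto
    then have [simp]: "dual_form e' \<bullet> e = 0" using dual_form(3)[OF e(2,1)] e by blast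
    have [simp]: "dual_form e \<bullet> e = 1" "dual_form e' \<bullet> e' = 1" using dual_form(2) e by auto
    consider "f = e" | "f = - e" | "f = e'" | "f = - e'"
      | "f \<noteq> e" "f \<noteq> - e" "f \<noteq> e'" "f \<noteq> - e'" by blast
    then show ?thesis
    proof cases
      case 5
      then have "dual_form e \<bullet> f = 0" "dual_form e' \<bullet> f = 0"
        using dual_form(3) e f by blast+
      then show ?thesis by (simp add: inner_add_left)
    qed (use t in \<open>auto simp: inner_add_left\<close>)
  qed
  then show "form_le w d 1 (dual_form e + t *\<^sub>R dual_form e')"
    unfolding form_le_def
    using harmonic_on_edge[OF H] slope_vec_dirs by (metis d_nonneg mult_right_mono)
qed

end

text \<open>The square x, y, v, u spanned by two independent directions, with y = e x, u = e' x, v =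
  e' y. The goal is \<open>transport\<close>, the comparison of opposite sides.\<close>

locale flat_square = flat_graph w \<mu> d B
  for w :: "'v::finite \<Rightarrow> 'v \<Rightarrow> real" and \<mu> and d and B +
  fixes e e' and x :: 'v
  assumes e: "e \<in> dirs" and e': "e' \<in> dirs" and ne: "e' \<noteq> e" "e' \<noteq> - e"
begin

abbreviation "y \<equiv> act e x"
abbreviation "u \<equiv> act e' x"
abbreviation "v \<equiv> act e' y"
abbreviation "\<xi> \<equiv> dual_form e"
abbreviation "\<xi>' \<equiv> dual_form e'"

lemma \<xi>_closed: "closed_form w d \<xi>" and \<xi>_le: "form_le w d 1 \<xi>"
  using form_le_dual_forms[OF e e' ne, of 0] by auto

lemma square_values [simp]: "\<xi> $ z $ act e z = d z (act e z)" "\<xi> $ z $ act e' z = 0"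
  "\<xi>' $ z $ act e z = 0" "\<xi>' $ z $ act e' z = d z (act e' z)"
proof -
  have "e \<noteq> - e'" using ne by auto
  then show "\<xi> $ z $ act e z = d z (act e z)" "\<xi> $ z $ act e' z = 0"
    "\<xi>' $ z $ act e z = 0" "\<xi>' $ z $ act e' z = d z (act e' z)"
    using dual_form(2,3) dual_form_act e e' ne by auto
qed

text \<open>The Lipschitz bound holds for \<xi> + t \<xi>' with t = 1 and t = -1. Where \<xi> alone
  attains it, the value of \<xi>' at b must be that at u, and positivity identifies b.\<close>

lemma tight_two_path:
  assumes b: "b \<in> nbh x" and tight: "\<xi> $ x $ b = d u b"
  shows "b = u"
proof -
  have u: "u \<in> nbh x" using e' by simp
  have le: "t * (\<xi>' $ x $ b - d x u) \<le> 0" if "\<bar>t\<bar> \<le> 1" for t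
    using lipschitz_two_path[OF form_le_dual_forms[OF e e' ne that] u b] tight
    by (simp add: algebra_simps)
  have "\<xi>' $ x $ b = d x u" using le[of 1] le[of "-1"] by simp
  then show ?thesis using dual_form_pos[OF e' b] adj_d_pos[OF act_adj[OF e', of x]] by simp
qed

text \<open>The same two-sided perturbation across the edge from x to y; the forced value of \<xi>'
  also yields the lengths of the sides.\<close>

lemma tight_three_path:
  assumes b: "b \<in> nbh y" and tight: "d x y + \<xi> $ y $ b = d u b"
  shows "b = v" "d y v = d x u" "d u v = d x y"
proof -
  have u: "u \<in> nbh x" using e' by simp
  have le: "t * (\<xi>' $ y $ b - d x u) \<le> 0" if "\<bar>t\<bar> \<le> 1" for t
    using lipschitz_three_path[OF form_le_dual_forms[OF e e' ne that] act_adj[OF e] u b] tight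
    by (simp add: algebra_simps)
  have eq: "\<xi>' $ y $ b = d x u" using le[of 1] le[of "-1"] by simp
  then show bv: "b = v" using dual_form_pos[OF e' b] adj_d_pos[OF act_adj[OF e', of x]] by simp
  show "d y v = d x u" using eq unfolding bv by simp
  show "d u v = d x y" using tight unfolding bv by simp
qed

abbreviation "f \<equiv> potential \<xi> x y"

lemma f_x: "z \<in> nbh x \<Longrightarrow> f z = \<xi> $ x $ z"
  and f_y: "z \<in> nbh y \<Longrightarrow> f z = d x y + \<xi> $ y $ z"
  and f_lip: "a \<in> nbh x \<union> nbh y \<Longrightarrow> b \<in> nbh x \<union> nbh y \<Longrightarrow> f b - f a \<le> d a b"
  using potential_nbh[OF \<xi>_closed \<xi>_le act_adj[OF e]] 
    potential_lipschitz[OF \<xi>_closed \<xi>_le act_adj[OF e]] by auto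

lemma f_u: "f u = 0"
  using f_x[of u] e' by simp

text \<open>The points where the Lipschitz bound of f from u is an equality, as f vanishes at u.
  Near x this is only u, near y at most v, by \<open>W_x\<close> and \<open>W_y\<close>.\<close>

definition W :: "'v set" where
  "W = {b \<in> nbh x \<union> nbh y. f b = d u b}"

lemma W_x: "z \<in> W \<Longrightarrow> z \<in> nbh x \<Longrightarrow> z = u"
  using tight_two_path[of z] f_x[of z] unfolding W_def by auto

lemma W_y: "z \<in> W \<Longrightarrow> z \<in> nbh y \<Longrightarrow> z = v"
  using tight_three_path(1)[of z] f_y[of z] unfolding W_def by auto

lemma u_in_W: "u \<in> W"
  using e' f_u unfolding W_def by auto

lemma x_notin_W: "x \<notin> W" and y_notin_W: "y \<notin> W"
proof -
  show "x \<notin> W" using W_x[of x] act_adj[OF e', of x] adj_irrefl by fastforce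
  show "y \<notin> W" using W_x[of y] act_inj_dir[OF e e', of x] e ne by auto
qed

lemma W_upward:
  assumes "a \<in> W" "b \<in> nbh x \<union> nbh y" "f b - f a = d a b"
  shows "b \<in> W"
proof -
  have "f b = d u a + d a b" using assms(1,3) by (simp add: W_def)
  then have "d u b \<le> f b" using d_triangle[of u b a] by simp
  moreover have "f b \<le> d u b" using f_lip[of u b] assms(2) u_in_W f_u by (auto simp: W_def)
  ultimately show ?thesis using assms(2) by (simp add: W_def)
qed

text \<open>
  Lowering \<open>f\<close> on the upward closed set \<open>W\<close> keeps it Lipschitz, so the curvature bound compares
  the mass of \<open>W\<close> seen from \<open>x\<close> and from \<open>y\<close>.
\<close>

lemma laplacian_indicator_le:
  "laplacian w \<mu> (indicator W) x \<le> laplacian w \<mu> (indicator W) y"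
proof -
  let ?Z = "nbh x \<union> nbh y"
  let ?A = "{(a, b). a \<in> ?Z \<and> b \<in> ?Z \<and> f b - f a < d a b}"
  obtain \<epsilon> where \<epsilon>: "0 < \<epsilon>"
    "\<And>p. p \<in> ?A \<Longrightarrow> \<epsilon> * 1 \<le> d (fst p) (snd p) - (f (snd p) - f (fst p))"
    by (rule small_multiplier_exists[of ?A "\<lambda>p. d (fst p) (snd p) - (f (snd p) - f (fst p))" 1 "\<lambda>_. 1"])
      auto
  define h where "h z = f z - \<epsilon> * indicator W z" for z
  have "h b - h a \<le> 1 * d a b" if ab: "a \<in> ?Z" "b \<in> ?Z" for a b
  proof (cases "f b - f a = d a b")
    case True
    then have "indicator W a \<le> (indicator W b :: real)"
      using W_upward[OF _ ab(2), of a] by (auto simp: indicator_def)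
    then have "\<epsilon> * indicator W a \<le> \<epsilon> * indicator W b" using \<epsilon>(1) by (intro mult_left_mono) auto
    then show ?thesis using True by (simp add: h_def)
  next
    case False
    then have "(a, b) \<in> ?A" using f_lip[OF ab] ab by auto
    from \<epsilon>(2)[OF this] have "\<epsilon> \<le> d a b - (f b - f a)" by simp
    then show ?thesis using \<epsilon>(1) by (auto simp: h_def indicator_def)
  qed
  moreover have "h y - h x = 1 * d x y"
    using x_notin_W y_notin_W f_x[of x] f_y[of y] one_form_diag[OF closed_form_one_form[OF \<xi>_closed]]
    by (simp add: h_def)
  ultimately have "laplacian w \<mu> h y \<le> laplacian w \<mu> h x"
    using laplacian_le_of_local_lipschitz[OF act_adj[OF e], of 1 h x] by auto
  moreover have "laplacian w \<mu> h z = laplacian w \<mu> f z - \<epsilon> * laplacian w \<mu> (indicator W) z" for z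
    unfolding h_def by (simp add: laplacian_diff laplacian_scale)
  moreover have "laplacian w \<mu> f x = 0" "laplacian w \<mu> f y = 0"
    using laplacian_potential[OF \<xi>_closed \<xi>_le act_adj[OF e]] H1_coclosed[OF dual_form(1)[OF e]]
    by auto
  ultimately show ?thesis using \<epsilon>(1) by simp
qed

text \<open>Seen from x, the set W has at least the mass of the edge to u, which is positive; seen
  from y, it has at most the mass of the edge to v. The comparison of Laplacians thus forces v into
  W, which fixes the lengths and compares the weights.\<close>

lemma transport:
  "w x u / \<mu> x \<le> w y v / \<mu> y" "d y v = d x u" "d u v = d x y"
proof -
  have "w x u / \<mu> x = (\<Sum>z\<in>{u}. w x z / \<mu> x * (indicator W z - indicator W x))"
    using u_in_W x_notin_W by simp
  also have "\<dots> \<le> laplacian w \<mu> (indicator W) x"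
    unfolding laplacian_def using x_notin_W
    by (intro sum_mono2) (auto simp: less_imp_le)
  also have "\<dots> \<le> laplacian w \<mu> (indicator W) y" by (rule laplacian_indicator_le)
  also have "\<dots> = (\<Sum>z\<in>{v}. w y z / \<mu> y * (indicator W z - indicator W y))"
    unfolding laplacian_def
  proof (rule sum.mono_neutral_right)
    show "\<forall>z\<in>UNIV - {v}. w y z / \<mu> y * (indicator W z - indicator W y) = 0"
    proof
      fix z assume z: "z \<in> UNIV - {v}"
      show "w y z / \<mu> y * (indicator W z - indicator W y) = 0"
        using z W_y[of z] y_notin_W w_eq_0[of y z]
        by (cases "adj w y z") (auto simp: indicator_def)
    qed
  qed auto
  also have "\<dots> = w y v / \<mu> y * indicator W v" using y_notin_W by simp
  finally have le: "w x u / \<mu> x \<le> w y v / \<mu> y * indicator W v" .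
  moreover have "0 < w x u / \<mu> x" using act_adj[OF e', of x] by (simp add: adj_def)
  ultimately have v: "v \<in> W" by (cases "v \<in> W") auto
  then show "w x u / \<mu> x \<le> w y v / \<mu> y" using le by simp
  have "v \<in> nbh y" using e' by simp
  moreover have "d x y + \<xi> $ y $ v = d u v" using v f_y[OF \<open>v \<in> nbh y\<close>] by (simp add: W_def)
  ultimately show "d y v = d x u" "d u v = d x y" using tight_three_path by blast+
qed

end

section \<open>Invariance of weights and commutation of the moves\<close>

context flat_graph begin

lemma act_transport:
  assumes "e \<in> dirs" "e' \<in> dirs" "e' \<noteq> e" "e' \<noteq> - e"
  shows "w x (act e' x) / \<mu> x \<le> w (act e x) (act e' (act e x)) / \<mu> (act e x)"
    and act_dist: "d (act e x) (act e' (act e x)) = d x (act e' x)"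
proof -
  interpret flat_square w \<mu> d B e e' x by unfold_locales (use assms in auto)
  show "w x (act e' x) / \<mu> x \<le> w (act e x) (act e' (act e x)) / \<mu> (act e x)"
    "d (act e x) (act e' (act e x)) = d x (act e' x)"
    by (fact transport)+
qed

text \<open>The weights do not decrease along the permutation \<open>act e\<close> of a finite set,
  and summing over all vertices is invariant under it, so no step increases strictly.\<close>

lemma act_weight:
  assumes "e \<in> dirs" "e' \<in> dirs" "e' \<noteq> e" "e' \<noteq> - e"
  shows "w x (act e' x) / \<mu> x = w (act e x) (act e' (act e x)) / \<mu> (act e x)"
proof (rule ccontr)
  let ?g = "\<lambda>x. w x (act e' x) / \<mu> x"
  assume "?g x \<noteq> ?g (act e x)"
  then have "?g x < ?g (act e x)" using act_transport(1)[OF assms, of x] by linarith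
  then have "sum ?g UNIV < (\<Sum>x\<in>UNIV. ?g (act e x))"
    by (intro sum_strict_mono_ex1) (use act_transport(1)[OF assms] in auto)
  also have "\<dots> = sum ?g UNIV"
    using inj_act[OF assms(1)] finite_UNIV_inj_surj[OF _ inj_act[OF assms(1)]]
    by (intro sum.reindex_bij_betw) (auto simp: bij_betw_def)
  finally show False by simp
qed

text \<open>Close u, x, y, v by a geodesic from v to u. The dual form of e contributes only d x y on
  the three edges, so the geodesic, whose length is d x y too, must carry it at full slope. Its
  first edge from v goes along -e and already has length d x y, hence it ends at u.\<close>

lemma act_commute:
  assumes e: "e \<in> dirs" and e': "e' \<in> dirs"
  shows "act e (act e' x) = act e' (act e x)"
proof (cases "e' = e \<or> e' = - e")
  case True
  then show ?thesis using e by auto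
next
  case False
  then interpret flat_square w \<mu> d B e e' x by unfold_locales (use assms in auto)
  have uv: "u \<noteq> v" using transport(3) adj_d_pos[OF act_adj[OF e, of x]] by auto
  have ux: "0 < d u x" "0 < d v y" using adj_d_pos act_adj[OF e'] d_sym by metis+
  obtain q where q: "geodesic w d (v # q @ [u])" "walk_length d (v # q @ [u]) = d v u"
    using geodesic_exists_Cons_snoc uv by metis
  \<comment> \<open>If x or y were on the geodesic, then d u v would exceed d x y by the length of a
    side, because the slope of f gives d x y as a lower bound for both diagonals.\<close>
  have sep: "z \<notin> set q" if z: "z = x \<or> z = y" for z
  proof
    assume "z \<in> set q"
    then obtain q1 q2 where "v # q @ [u] = (v # q1) @ z # (q2 @ [u])"
      by (metis split_list append_Cons append_assoc)
    then have eq: "d v u = d v z + d z u"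
      using geodesic_split(3)[of "v # q1" z "q2 @ [u]"] q(1) by auto
    have n: "u \<in> nbh x \<union> nbh y" "v \<in> nbh x \<union> nbh y" "x \<in> nbh x" "y \<in> nbh y"
      using e' by auto
    have "f u = 0" "f x = 0" "f y = d x y" "f v = d x y"
      using f_u f_x[of x] f_y[of y] f_y[of v] e' one_form_diag[OF closed_form_one_form[OF \<xi>_closed]]
      by auto
    then have "d x y \<le> d x v" "d x y \<le> d u y"
      using f_lip[of x v] f_lip[of u y] n by auto
    then show False
      using z eq ux transport(3) d_sym[of u v] d_sym[of x v] d_sym[of u y] d_sym[of u x] by auto
  qed
  have xv: "x \<noteq> v" "x \<noteq> u" "y \<noteq> v" "y \<noteq> u"
  proof -
    show "x \<noteq> u" "y \<noteq> v" using act_adj[OF e'] adj_irrefl by metis+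
    show "y \<noteq> u" using act_inj_dir[OF e e'] ne by metis
    show "x \<noteq> v"
    proof
      assume "x = v"
      then have "act (- e) y = act e' y" using act_uminus_act[OF e, of x] by metis
      then show False using act_inj_dir[OF dirs_uminus[OF e] e'] ne by metis
    qed
  qed
  have lt: "d u v < d u x + d x y + d y v"
    using transport(3) ux d_nonneg[of y v] by linarith
  note of = closed_form_one_form[OF \<xi>_closed]
  have "adj w u x" using act_adj[OF e'] adj_sym by blast
  from closed_form_three_path[OF \<xi>_closed this act_adj[OF e] act_adj[OF e'] q(1) _ _ lt]
  have "\<xi> $ u $ x + \<xi> $ x $ y + \<xi> $ y $ v + walk_length (\<lambda>x y. \<xi> $ x $ y) (v # q @ [u]) = 0"
    using sep xv by auto
  then have sum: "- walk_length (\<lambda>x y. \<xi> $ x $ y) (v # q @ [u]) = d v u"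
    using one_form_antisym[OF of, of u x] transport(3) d_sym[of u v] by simp
  obtain g r where gr: "q @ [u] = g # r" by (cases q) auto
  have succ: "adj w v g" "successively (adj w) (g # r)"
    using q(1) gr by (auto simp: geodesic_def walk_betw_iff_successively)
  have "- \<xi> $ v $ g \<le> 1 * d v g" using form_le_nbh(2)[OF of \<xi>_le, of g v] succ by simp
  moreover have "- walk_length (\<lambda>x y. \<xi> $ x $ y) (g # r) \<le> 1 * walk_length d (g # r)"
    by (rule form_le_walk_length[OF of \<xi>_le succ(2)])
  \<comment> \<open>The bounds for the first edge and for the rest add up to the attained total, so
    each is attained.\<close>
  ultimately have "- \<xi> $ v $ g = d v g" using sum q(2) gr by simp
  then have pos: "\<xi> $ g $ v = d v g" using one_form_antisym[OF of, of g v] by simp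
  have "v \<in> nbh g" using succ(1) adj_sym by simp
  then have v: "v = act e g" using dual_form_pos[OF e, of v g] pos adj_d_pos[OF succ(1)] by simp
  then have g: "g = act (- e) v" using e by simp
  have "- e \<noteq> e'" "- e \<noteq> - e'" using ne by auto
  \<comment> \<open>Lengths in direction -e are preserved by \<open>act e'\<close>, so the edge from
    v to g is as long as that from y to x and nothing remains of the geodesic.\<close>
  from act_dist[OF e' dirs_uminus[OF e] this, of y]
  have "d v g = d y x" using g e by simp
  then have "walk_length d (g # r) = 0" using q(2) gr transport(3) d_sym[of u v] d_sym[of x y] by simp
  moreover have "walk_betw w g (g # r) u"
  proof -
    have "last (g # r) = u" using gr by (metis last_snoc)
    then show ?thesis using succ(2) by (simp add: walk_betw_iff_successively)
  qed
  ultimately have "d g u \<le> 0" using d_le_walk_length by metis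
  then have "g = u" using d_pos[of g u] by force
  then show ?thesis using v by simp
qed

end

section \<open>The group structure\<close>

context flat_graph begin

text \<open>The group will be that of the maps commuting with all moves. Connectedness determines
  such a map by one value, and commutation of the moves makes products of moves equivariant, so the
  action is simply transitive.\<close>

definition equivariant :: "('v \<Rightarrow> 'v) \<Rightarrow> bool" where
  "equivariant g \<longleftrightarrow> (\<forall>e\<in>dirs. \<forall>x. g (act e x) = act e (g x))"

lemma act_induct [case_names base act]:
  assumes "P x0" "\<And>e x. e \<in> dirs \<Longrightarrow> P x \<Longrightarrow> P (act e x)"
  shows "P x"
  using reachable[of x0 x]
  by (induction rule: rtranclp_induct) (auto simp: adj_iff_act intro: assms)

lemma equivariant_unique:
  assumes "equivariant g" "equivariant h" "g x0 = h x0"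
  shows "g = h"
proof
  fix x show "g x = h x"
    by (induction x rule: act_induct[of _ x0]) (use assms in \<open>auto simp: equivariant_def\<close>)
qed

lemma equivariant_act: "e \<in> dirs \<Longrightarrow> equivariant (act e)"
  by (simp add: equivariant_def act_commute)

lemma equivariant_comp: "equivariant g \<Longrightarrow> equivariant h \<Longrightarrow> equivariant (g \<circ> h)"
  by (simp add: equivariant_def)

lemma equivariant_exists: "\<exists>g. equivariant g \<and> g x0 = x"
proof (induction x rule: act_induct[of _ x0])
  case base
  show ?case by (rule exI[of _ id]) (simp add: equivariant_def)
next
  case (act e x)
  then obtain g where "equivariant g" "g x0 = x" by blast
  then show ?case
    using equivariant_comp[OF equivariant_act[OF act(1)]] by (metis comp_apply)
qed

definition origin :: 'v where "origin = undefined"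

text \<open>Evaluation at \<open>origin\<close> identifies equivariant maps with vertices;
  composition of maps becomes the product of vertices.\<close>

definition translation :: "'v \<Rightarrow> 'v \<Rightarrow> 'v" where
  "translation x = (THE g. equivariant g \<and> g origin = x)"

lemma equivariant_translation: "equivariant (translation x)"
  and translation_origin [simp]: "translation x origin = x"
proof -
  have "\<exists>!g. equivariant g \<and> g origin = x"
    using equivariant_exists[of origin x] equivariant_unique[of _ _ origin] by blast
  then have "equivariant (translation x) \<and> translation x origin = x"
    unfolding translation_def by (rule theI')
  then show "equivariant (translation x)" "translation x origin = x" by auto
qed

lemma translation_eqI: "equivariant g \<Longrightarrow> g origin = x \<Longrightarrow> translation x = g"
  using equivariant_unique[OF equivariant_translation, of g x origin] by simp

lemma translation_act: "e \<in> dirs \<Longrightarrow> translation x (act e y) = act e (translation x y)"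
  using equivariant_translation[of x] by (simp add: equivariant_def)

lemma translation_act_left: "e \<in> dirs \<Longrightarrow> translation (act e x) y = act e (translation x y)"
  using translation_eqI[OF equivariant_comp[OF equivariant_act equivariant_translation], of e x]
  by simp

lemma translation_origin_left [simp]: "translation origin x = x"
  using translation_eqI[of id origin] by (simp add: equivariant_def)

lemma translation_assoc: "translation (translation x y) z = translation x (translation y z)"
  using translation_eqI[OF equivariant_comp[OF equivariant_translation[of x] equivariant_translation[of y]]]
  by simp

lemma translation_commute: "translation x y = translation y x"
  by (induction y rule: act_induct[of _ origin]) (simp_all add: translation_act translation_act_left)

lemma translation_inverse: "\<exists>y. translation y x = origin"
proof (induction x rule: act_induct[of _ origin])
  case base
  show ?case by (rule exI[of _ origin]) simp
next
  case (act e x)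
  then obtain y where "translation y x = origin" by blast
  then have "translation (act (- e) y) (act e x) = origin"
    using act(1) by (simp add: translation_act translation_act_left)
  then show ?case by blast
qed

section \<open>The vertices as an abelian group and the axioms of a flat torus\<close>

definition torus :: "'v monoid" where
  "torus = \<lparr>carrier = UNIV, monoid.mult = translation, one = origin\<rparr>"

lemma torus_simps [simp]:
  "carrier torus = UNIV" "x \<otimes>\<^bsub>torus\<^esub> y = translation x y" "\<one>\<^bsub>torus\<^esub> = origin"
  by (simp_all add: torus_def)

lemma comm_group_torus: "comm_group torus"
proof (rule comm_groupI)
  show "x \<otimes>\<^bsub>torus\<^esub> y = y \<otimes>\<^bsub>torus\<^esub> x" for x y
    using translation_commute by simp
qed (simp_all add: translation_assoc translation_inverse)

lemma torus_int_pow_1: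
  assumes "e \<in> dirs"
  shows "act e origin [^]\<^bsub>torus\<^esub> (1::int) = act e origin"
    and "act e origin [^]\<^bsub>torus\<^esub> (-1::int) = act (- e) origin"
proof -
  interpret comm_group torus by (rule comm_group_torus)
  show "act e origin [^]\<^bsub>torus\<^esub> (1::int) = act e origin"
    using int_pow_1[of "act e origin"] by simp
  have "inv\<^bsub>torus\<^esub> (act e origin) = act (- e) origin"
    by (rule inv_equality) (use assms in \<open>simp_all add: translation_act_left\<close>)
  then show "act e origin [^]\<^bsub>torus\<^esub> (-1::int) = act (- e) origin"
    using int_pow_neg[of "act e origin" 1] int_pow_1[of "act e origin"] by simp
qed

lemma torus_act:
  assumes "e \<in> dirs"
  shows "act e origin [^]\<^bsub>torus\<^esub> (1::int) \<otimes>\<^bsub>torus\<^esub> x = act e x"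
    and "act e origin [^]\<^bsub>torus\<^esub> (-1::int) \<otimes>\<^bsub>torus\<^esub> x = act (- e) x"
  using torus_int_pow_1[OF assms] assms dirs_uminus[OF assms] by (simp_all add: translation_act_left)

lemma generate_torus: "generate torus ((\<lambda>e. act e origin) ` B) = UNIV"
proof -
  interpret comm_group torus by (rule comm_group_torus)
  let ?G = "generate torus ((\<lambda>e. act e origin) ` B)"
  have "act e origin \<in> ?G" if e: "e \<in> dirs" for e
  proof (cases "e \<in> B")
    case True
    then show ?thesis by (intro generate.incl) blast
  next
    case False
    then have b: "- e \<in> B" "- e \<in> dirs" using e by (auto simp: dirs_def)
    have "inv\<^bsub>torus\<^esub> (act (- e) origin) = act e origin"
      by (rule inv_equality) (use e in \<open>simp_all add: translation_act_left\<close>)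
    moreover have "inv\<^bsub>torus\<^esub> (act (- e) origin) \<in> ?G" using b by (intro generate.inv) blast
    ultimately show ?thesis by simp
  qed
  note gen = this
  have "x \<in> ?G" for x
  proof (induction x rule: act_induct[of _ origin])
    case base
    show ?case using generate.one[of torus] by simp
  next
    case (act e x)
    then have "act e origin \<otimes>\<^bsub>torus\<^esub> x \<in> ?G" using gen by (intro generate.eng) auto
    then show ?case using act(1) by (simp add: translation_act_left)
  qed
  then show ?thesis by blast
qed

text \<open>The dual form of e is coclosed, and only the edges along e and -e contribute to its
  adjoint coboundary at x.\<close>

lemma dual_form_balance:
  assumes e: "e \<in> dirs"
  shows "w x (act e x) * d x (act e x) = w x (act (- e) x) * d x (act (- e) x)"
proof -
  have ne: "act e x \<noteq> act (- e) x"
  proof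
    assume "act e x = act (- e) x"
    then have "e = - e" using act_inj_dir[OF e dirs_uminus[OF e]] by blast
    moreover have "e \<noteq> 0" using dual_form(2)[OF e] by auto
    ultimately show False using neq_uminus_self by blast
  qed
  let ?\<xi> = "dual_form e"
  have "0 = (\<Sum>y\<in>UNIV. w x y / \<mu> x * ?\<xi> $ x $ y)"
    using H1_coclosed[OF dual_form(1)[OF e], of x] by (simp add: coboundary_adjoint_def)
  also have "\<dots> = (\<Sum>y\<in>{act e x, act (- e) x}. w x y / \<mu> x * ?\<xi> $ x $ y)"
  proof (rule sum.mono_neutral_right)
    show "\<forall>y\<in>UNIV - {act e x, act (- e) x}. w x y / \<mu> x * ?\<xi> $ x $ y = 0"
    proof
      fix y assume y: "y \<in> UNIV - {act e x, act (- e) x}"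
      show "w x y / \<mu> x * ?\<xi> $ x $ y = 0"
      proof (cases "adj w x y")
        case True
        then obtain e' where e': "e' \<in> dirs" "y = act e' x" using adj_iff_act by blast
        then have "e' \<noteq> e" "e' \<noteq> - e" using y by auto
        then show ?thesis using dual_form_act[OF e e'(1), of x] dual_form(3)[OF e e'(1)] e'(2) by simp
      qed (simp add: w_eq_0)
    qed
  qed auto
  also have "\<dots> = w x (act e x) / \<mu> x * d x (act e x) - w x (act (- e) x) / \<mu> x * d x (act (- e) x)"
    using ne dual_form_act[OF e e, of x] dual_form_act[OF e dirs_uminus[OF e], of x] dual_form(2)[OF e]
    by simp
  finally show ?thesis using \<mu>_pos[of x] by (simp add: field_simps)
qed

lemma weighted_flat_torus_exists:
  assumes "card B = betti1 w \<mu> d"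
  shows "\<exists>(A :: 'v monoid) a. weighted_flat_torus A (betti1 w \<mu> d) a w \<mu> d"
proof -
  define m where "m = betti1 w \<mu> d"
  obtain b where b: "bij_betw b {1..m} B"
    using ex_bij_betw_nat_finite_1[OF independent_imp_finite[OF indep_B]] assms m_def by metis
  have bB: "b i \<in> B" if "i \<in> {1..m}" for i using bij_betwE[OF b] that by blast
  then have bd: "b i \<in> dirs" if "i \<in> {1..m}" for i using that by (simp add: dirs_def)
  have b_inj: "b i \<noteq> b j" if "i \<in> {1..m}" "j \<in> {1..m}" "i \<noteq> j" for i j
    using inj_onD[OF bij_betw_imp_inj_on[OF b]] that by metis
  have b_neg: "b i \<noteq> - b j" "- b i \<noteq> b j" if "i \<in> {1..m}" "j \<in> {1..m}" for i j
  proof -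
    have "- b i \<in> uminus ` B" "- b j \<in> uminus ` B" using bB that by (auto intro: imageI)
    then show "b i \<noteq> - b j" "- b i \<noteq> b j"
      using bB[OF that(1)] bB[OF that(2)] disj_B by (metis disjoint_iff)+
  qed
  have dirs_b: "e \<in> dirs \<longleftrightarrow> (\<exists>i\<in>{1..m}. e = b i \<or> e = - b i)" for e
    using bij_betw_imp_surj_on[OF b] unfolding dirs_def by blast
  define a where "a i = act (b i) origin" for i
  have pow: "a i [^]\<^bsub>torus\<^esub> \<epsilon> = act (if \<epsilon> = 1 then b i else - b i) origin"
    and acts: "a i [^]\<^bsub>torus\<^esub> \<epsilon> \<otimes>\<^bsub>torus\<^esub> x = act (if \<epsilon> = 1 then b i else - b i) x"
    if "i \<in> {1..m}" "\<epsilon> \<in> {-1, 1::int}" for i \<epsilon> x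
    unfolding a_def
    using that torus_int_pow_1[OF bd[OF that(1)]] torus_act[OF bd[OF that(1)], of x] by auto
  have sd: "(if \<epsilon> = 1 then b i else - b i) \<in> dirs" if "i \<in> {1..m}" for i and \<epsilon> :: int
    using bd[OF that] by simp
  have sne: "(if \<epsilon> = 1 then b i else - b i) \<noteq> (if \<delta> = 1 then b j else - b j)"
    "(if \<epsilon> = 1 then b i else - b i) \<noteq> - (if \<delta> = 1 then b j else - b j)"
    if "i \<in> {1..m}" "j \<in> {1..m}" "i \<noteq> j" for i j and \<epsilon> \<delta> :: int
    using b_inj[OF that] b_neg[OF that(1,2)] by simp_all
  have "weighted_flat_torus torus m a w \<mu> d"
    unfolding weighted_flat_torus_def Let_def
  proof (intro conjI allI ballI impI)
    show "comm_group torus" by (rule comm_group_torus)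
    show "carrier torus = UNIV" by simp
    have "a ` {1..m} = (\<lambda>e. act e origin) ` B"
      unfolding a_def bij_betw_imp_surj_on[OF b, symmetric] image_image ..
    then show "generate torus (a ` {1..m}) = UNIV" using generate_torus by simp
    show "general_path_distance w d" by (rule path_distance)
    show "betti1 w \<mu> d = m" by (simp add: m_def)
  next
    fix i j \<epsilon> assume ij: "i \<in> {1..m}" "j \<in> {1..m}" "\<epsilon> \<in> {-1, 1::int}" "i \<noteq> j"
    show "a i \<noteq> a j [^]\<^bsub>torus\<^esub> \<epsilon>"
    proof
      assume "a i = a j [^]\<^bsub>torus\<^esub> \<epsilon>"
      then have "act (b i) origin = act (if \<epsilon> = 1 then b j else - b j) origin"
        unfolding pow[OF ij(2,3)] unfolding a_def .
      from act_inj_dir[OF bd[OF ij(1)] sd[OF ij(2)] this] show False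
        using sne(1)[OF ij(1,2,4), of 1 \<epsilon>] by simp
    qed
  next
    fix x y
    have "0 < w x y \<longleftrightarrow> (\<exists>e\<in>dirs. y = act e x)" using adj_iff_act by (simp add: adj_def)
    also have "\<dots> \<longleftrightarrow> (\<exists>i\<in>{1..m}. \<exists>\<epsilon>\<in>{-1, 1::int}. y = act (if \<epsilon> = 1 then b i else - b i) x)"
      using dirs_b by auto
    also have "\<dots> \<longleftrightarrow> (\<exists>i\<in>{1..m}. \<exists>\<epsilon>\<in>{-1, 1}. y = a i [^]\<^bsub>torus\<^esub> (\<epsilon>::int) \<otimes>\<^bsub>torus\<^esub> x)"
      by (intro bex_cong refl arg_cong[of _ _ "\<lambda>z. y = z"] acts[symmetric])
    finally show "0 < w x y \<longleftrightarrow> (\<exists>i\<in>{1..m}. \<exists>\<epsilon>\<in>{-1, 1}. y = a i [^]\<^bsub>torus\<^esub> (\<epsilon>::int) \<otimes>\<^bsub>torus\<^esub> x)" .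
  next
    fix x i assume i: "i \<in> {1..m}"
    show "w x (a i [^]\<^bsub>torus\<^esub> (1::int) \<otimes>\<^bsub>torus\<^esub> x) * d x (a i [^]\<^bsub>torus\<^esub> (1::int) \<otimes>\<^bsub>torus\<^esub> x)
      = w x (a i [^]\<^bsub>torus\<^esub> (-1::int) \<otimes>\<^bsub>torus\<^esub> x) * d x (a i [^]\<^bsub>torus\<^esub> (-1::int) \<otimes>\<^bsub>torus\<^esub> x)"
      using acts[OF i] dual_form_balance[OF bd[OF i], of x] by simp
  next
    fix x i j \<epsilon>1 \<epsilon>2
    assume ij: "i \<in> {1..m}" "j \<in> {1..m}" "\<epsilon>1 \<in> {-1, 1::int}" "\<epsilon>2 \<in> {-1, 1::int}" "i \<noteq> j"
    show "w x (a i [^]\<^bsub>torus\<^esub> \<epsilon>1 \<otimes>\<^bsub>torus\<^esub> x) / \<mu> x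
      = w (a j [^]\<^bsub>torus\<^esub> \<epsilon>2 \<otimes>\<^bsub>torus\<^esub> x)
          (a i [^]\<^bsub>torus\<^esub> \<epsilon>1 \<otimes>\<^bsub>torus\<^esub> (a j [^]\<^bsub>torus\<^esub> \<epsilon>2 \<otimes>\<^bsub>torus\<^esub> x))
        / \<mu> (a j [^]\<^bsub>torus\<^esub> \<epsilon>2 \<otimes>\<^bsub>torus\<^esub> x)"
      unfolding acts[OF ij(1,3)] acts[OF ij(2,4)]
      by (rule act_weight[OF sd[OF ij(2)] sd[OF ij(1)] sne[OF ij(1,2,5)]])
  next
    fix x i j assume ij: "i \<in> {1..m}" "j \<in> {1..m}" "i \<noteq> j"
    have 1: "(1::int) \<in> {-1, 1}" by simp
    show "d x (a i [^]\<^bsub>torus\<^esub> (1::int) \<otimes>\<^bsub>torus\<^esub> x)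
      = d (a j [^]\<^bsub>torus\<^esub> (1::int) \<otimes>\<^bsub>torus\<^esub> x)
          (a i [^]\<^bsub>torus\<^esub> (1::int) \<otimes>\<^bsub>torus\<^esub> (a j [^]\<^bsub>torus\<^esub> (1::int) \<otimes>\<^bsub>torus\<^esub> x))"
      unfolding acts[OF ij(1) 1] acts[OF ij(2) 1]
      by (rule act_dist[OF sd[OF ij(2)] sd[OF ij(1)] sne[OF ij], symmetric])
  qed
  then show ?thesis unfolding m_def by blast
qed

end

text \<open>The slope vectors at each vertex include all of B and -B, as many as the degree allows.
  So \<open>slope_vec x\<close> is injective with no further values, and the equality case
  applies.\<close>

lemma (in nonneg_curved_graph) weighted_flat_torus_of_max_degree:
  assumes m: "1 \<le> betti1 w \<mu> d" and deg: "max_degree w \<le> 2 * betti1 w \<mu> d"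
  shows "\<exists>(A :: 'v monoid) a. weighted_flat_torus A (betti1 w \<mu> d) a w \<mu> d"
proof -
  obtain B where B: "independent B" "card B = betti1 w \<mu> d" "span B = H1 w \<mu> d"
    "B \<inter> uminus ` B = {}" "\<And>x. B \<union> uminus ` B \<subseteq> slope_vec x ` {y. adj w x y}"
    using slope_vec_basis[OF m] by metis
  have card: "card (B \<union> uminus ` B) = 2 * betti1 w \<mu> d"
    using B(2,4) independent_imp_finite[OF B(1)] card_image[of uminus B]
    by (simp add: card_Un_disjoint)
  have "bij_betw (slope_vec x) {y. adj w x y} (B \<union> uminus ` B)" for x
  proof -
    have "card {y. adj w x y} = vertex_degree w x"
      unfolding vertex_degree_def using adj_sym by metis
    also have "\<dots> \<le> max_degree w" unfolding max_degree_def by (rule Max_ge) auto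
    finally have le: "card {y. adj w x y} \<le> card (B \<union> uminus ` B)" using deg card by simp
    have le': "card (B \<union> uminus ` B) \<le> card (slope_vec x ` {y. adj w x y})"
      by (intro card_mono B(5)) simp
    have le'': "card (slope_vec x ` {y. adj w x y}) \<le> card {y. adj w x y}"
      by (rule card_image_le) simp
    have "inj_on (slope_vec x) {y. adj w x y}"
      by (rule eq_card_imp_inj_on) (use le le' le'' in auto)
    moreover have "B \<union> uminus ` B = slope_vec x ` {y. adj w x y}"
      by (rule card_subset_eq) (use B(5) le le' le'' in auto)
    ultimately show ?thesis by (simp add: bij_betw_def)
  qed
  then interpret flat_graph w \<mu> d B by unfold_locales (use B in auto)
  show ?thesis by (rule weighted_flat_torus_exists[OF B(2)])
qed

section \<open>Weighted flat tori\<close>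

locale torus_graph = metric_graph w \<mu> d
  for w :: "'v::finite \<Rightarrow> 'v \<Rightarrow> real" and \<mu> and d +
  fixes A :: "'v monoid" and m :: nat and a :: "nat \<Rightarrow> 'v"
  assumes flat_torus: "weighted_flat_torus A m a w \<mu> d"
begin

sublocale comm_group A
  using flat_torus by (simp add: weighted_flat_torus_def Let_def)

lemma carrier [simp]: "carrier A = UNIV"
  using flat_torus by (simp add: weighted_flat_torus_def Let_def)

lemma gen_pow: "(a i [^]\<^bsub>A\<^esub> (1::int)) = a i" "(a i [^]\<^bsub>A\<^esub> (-1::int)) = inv\<^bsub>A\<^esub> a i"
  using int_pow_1[of "a i"] int_pow_neg[of "a i" 1] by simp_all

lemma adj_iff_generator:
  "adj w x y \<longleftrightarrow> (\<exists>i\<in>{1..m}. y = a i \<otimes>\<^bsub>A\<^esub> x \<or> y = inv\<^bsub>A\<^esub> a i \<otimes>\<^bsub>A\<^esub> x)"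
  using flat_torus unfolding weighted_flat_torus_def Let_def adj_def by (auto simp: gen_pow)

lemma generator_balance:
  "i \<in> {1..m} \<Longrightarrow> w x (a i \<otimes>\<^bsub>A\<^esub> x) * d x (a i \<otimes>\<^bsub>A\<^esub> x)
    = w x (inv\<^bsub>A\<^esub> a i \<otimes>\<^bsub>A\<^esub> x) * d x (inv\<^bsub>A\<^esub> a i \<otimes>\<^bsub>A\<^esub> x)"
  using flat_torus unfolding weighted_flat_torus_def Let_def by (auto simp: gen_pow)

lemma generator_weight:
  assumes "i \<in> {1..m}" "j \<in> {1..m}" "j \<noteq> i" "g = a j \<or> g = inv\<^bsub>A\<^esub> a j"
  shows "w x (g \<otimes>\<^bsub>A\<^esub> x) / \<mu> x
    = w (a i \<otimes>\<^bsub>A\<^esub> x) (g \<otimes>\<^bsub>A\<^esub> (a i \<otimes>\<^bsub>A\<^esub> x)) / \<mu> (a i \<otimes>\<^bsub>A\<^esub> x)"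
proof -
  have "\<forall>x. \<forall>i\<in>{1..m}. \<forall>j\<in>{1..m}. \<forall>\<epsilon>1\<in>{-1, 1::int}. \<forall>\<epsilon>2\<in>{-1, 1::int}. i \<noteq> j \<longrightarrow>
      w x (a i [^]\<^bsub>A\<^esub> \<epsilon>1 \<otimes>\<^bsub>A\<^esub> x) / \<mu> x
      = w (a j [^]\<^bsub>A\<^esub> \<epsilon>2 \<otimes>\<^bsub>A\<^esub> x) (a i [^]\<^bsub>A\<^esub> \<epsilon>1 \<otimes>\<^bsub>A\<^esub> (a j [^]\<^bsub>A\<^esub> \<epsilon>2 \<otimes>\<^bsub>A\<^esub> x))
        / \<mu> (a j [^]\<^bsub>A\<^esub> \<epsilon>2 \<otimes>\<^bsub>A\<^esub> x)"
    using flat_torus unfolding weighted_flat_torus_def Let_def by blast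
  then have "w x (a j [^]\<^bsub>A\<^esub> \<epsilon> \<otimes>\<^bsub>A\<^esub> x) / \<mu> x
      = w (a i [^]\<^bsub>A\<^esub> (1::int) \<otimes>\<^bsub>A\<^esub> x) (a j [^]\<^bsub>A\<^esub> \<epsilon> \<otimes>\<^bsub>A\<^esub> (a i [^]\<^bsub>A\<^esub> (1::int) \<otimes>\<^bsub>A\<^esub> x))
        / \<mu> (a i [^]\<^bsub>A\<^esub> (1::int) \<otimes>\<^bsub>A\<^esub> x)" if "\<epsilon> \<in> {-1, 1::int}" for \<epsilon>
    using assms that by blast
  from this[of 1] this[of "-1"] show ?thesis using assms(4) by (auto simp: gen_pow)
qed

text \<open>The axiom on distances speaks of the generators themselves; for an inverse, apply it at
  the translated vertex.\<close>

lemma generator_dist: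
  assumes "i \<in> {1..m}" "j \<in> {1..m}" "j \<noteq> i" "g = a j \<or> g = inv\<^bsub>A\<^esub> a j"
  shows "d (g \<otimes>\<^bsub>A\<^esub> x) (g \<otimes>\<^bsub>A\<^esub> (a i \<otimes>\<^bsub>A\<^esub> x)) = d x (a i \<otimes>\<^bsub>A\<^esub> x)"
proof -
  have dist: "d z (a i \<otimes>\<^bsub>A\<^esub> z) = d (a j \<otimes>\<^bsub>A\<^esub> z) (a i \<otimes>\<^bsub>A\<^esub> (a j \<otimes>\<^bsub>A\<^esub> z))" for z
    using flat_torus assms(1-3) unfolding weighted_flat_torus_def Let_def gen_pow by metis
  have comm: "g \<otimes>\<^bsub>A\<^esub> (a i \<otimes>\<^bsub>A\<^esub> x) = a i \<otimes>\<^bsub>A\<^esub> (g \<otimes>\<^bsub>A\<^esub> x)"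
    by (rule m_lcomm) auto
  from assms(4) show ?thesis
  proof
    assume "g = a j"
    then show ?thesis using dist[of x] comm by simp
  next
    assume g: "g = inv\<^bsub>A\<^esub> a j"
    have "a j \<otimes>\<^bsub>A\<^esub> (g \<otimes>\<^bsub>A\<^esub> x) = x" using m_assoc[of "a j" g x] by (simp add: g)
    then show ?thesis using dist[of "g \<otimes>\<^bsub>A\<^esub> x"] comm by simp
  qed
qed

lemma bij_mult_right: "bij (\<lambda>g. g \<otimes>\<^bsub>A\<^esub> x)"
proof -
  have "inj (\<lambda>g. g \<otimes>\<^bsub>A\<^esub> x)" by (rule injI) simp
  then show ?thesis using finite_UNIV_inj_surj[OF finite] by (simp add: bij_def)
qed

lemma laplacian_translate:
  "laplacian w \<mu> f x
    = (\<Sum>g\<in>UNIV. w x (g \<otimes>\<^bsub>A\<^esub> x) / \<mu> x * (f (g \<otimes>\<^bsub>A\<^esub> x) - f x))"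
  unfolding laplacian_def by (rule sum.reindex_bij_betw[OF bij_mult_right, symmetric])

text \<open>Compare the two Laplacians by group elements. For other generators and their inverses,
  translation by \<open>a i\<close> preserves weights and distances, so the terms compare one by
  one. The terms along the edge itself are treated as a pair, by the balance condition.\<close>

lemma laplacian_le_generator:
  assumes i: "i \<in> {1..m}" and lip: "\<And>z z'. f z' - f z \<le> d z z'"
    and f: "f (a i \<otimes>\<^bsub>A\<^esub> x) - f x = d x (a i \<otimes>\<^bsub>A\<^esub> x)"
  shows "laplacian w \<mu> f (a i \<otimes>\<^bsub>A\<^esub> x) \<le> laplacian w \<mu> f x"
proof -
  define c where "c = a i"
  define c' where "c' = inv\<^bsub>A\<^esub> a i"
  define y where "y = a i \<otimes>\<^bsub>A\<^esub> x"
  define T where "T z g = w z (g \<otimes>\<^bsub>A\<^esub> z) / \<mu> z * (f (g \<otimes>\<^bsub>A\<^esub> z) - f z)" for z g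
  have fxy: "f y - f x = d x y" using f by (simp add: y_def)
  have c'y: "c' \<otimes>\<^bsub>A\<^esub> y = x" using m_assoc[of c' "a i" x] by (simp add: c'_def y_def)
  have upper: "w z z' / \<mu> z * (f z' - f z) \<le> w z z' / \<mu> z * d z z'" for z z'
    by (intro mult_left_mono lip) (simp add: less_imp_le)
  have lower: "- (w z z' / \<mu> z * d z z') \<le> w z z' / \<mu> z * (f z' - f z)" for z z'
  proof -
    have "w z z' / \<mu> z * (- d z z') \<le> w z z' / \<mu> z * (f z' - f z)"
      using lip[of z z'] d_sym[of z z'] by (intro mult_left_mono) (simp_all add: less_imp_le)
    then show ?thesis by simp
  qed
  have bal: "w z (c \<otimes>\<^bsub>A\<^esub> z) / \<mu> z * d z (c \<otimes>\<^bsub>A\<^esub> z)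
      = w z (c' \<otimes>\<^bsub>A\<^esub> z) / \<mu> z * d z (c' \<otimes>\<^bsub>A\<^esub> z)" for z
    using generator_balance[OF i, of z] by (simp add: c_def c'_def)
  have Txc: "T x c = w x y / \<mu> x * d x y"
    using fxy by (simp add: T_def c_def y_def)
  have Tyc': "T y c' = - (w y x / \<mu> y * d y x)"
  proof -
    have "f x - f y = - d y x" using fxy d_sym[of x y] by linarith
    then show ?thesis unfolding T_def c'y by simp
  qed
  \<comment> \<open>At y the step back lowers f by the full distance, and by balance the step
    forward cannot outweigh it; at x the roles are reversed. If \<open>a i\<close> is its own
    inverse there is only one term, of the right sign.\<close>
  have pair: "(\<Sum>g\<in>{c, c'}. T y g) \<le> 0" "0 \<le> (\<Sum>g\<in>{c, c'}. T x g)"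
  proof -
    show "(\<Sum>g\<in>{c, c'}. T y g) \<le> 0"
    proof (cases "c = c'")
      case True
      then show ?thesis using Tyc' by (simp add: less_imp_le)
    next
      case False
      have "T y c \<le> w y (c \<otimes>\<^bsub>A\<^esub> y) / \<mu> y * d y (c \<otimes>\<^bsub>A\<^esub> y)" unfolding T_def by (rule upper)
      then have "T y c + T y c' \<le> 0" using bal[of y] Tyc' unfolding c'y by linarith
      then show ?thesis using False by simp
    qed
    show "0 \<le> (\<Sum>g\<in>{c, c'}. T x g)"
    proof (cases "c = c'")
      case True
      then show ?thesis using Txc by (simp add: less_imp_le)
    next
      case False
      have "- (w x (c' \<otimes>\<^bsub>A\<^esub> x) / \<mu> x * d x (c' \<otimes>\<^bsub>A\<^esub> x)) \<le> T x c'"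
        unfolding T_def by (rule lower)
      moreover have "T x c = w x (c \<otimes>\<^bsub>A\<^esub> x) / \<mu> x * d x (c \<otimes>\<^bsub>A\<^esub> x)"
        using Txc by (simp add: c_def y_def)
      ultimately have "0 \<le> T x c + T x c'" using bal[of x] by linarith
      then show ?thesis using False by simp
    qed
  qed
  have rest: "T y g \<le> T x g" if g: "g \<notin> {c, c'}" for g
  proof (cases "\<exists>j\<in>{1..m}. g = a j \<or> g = inv\<^bsub>A\<^esub> a j")
    case True
    then obtain j where j: "j \<in> {1..m}" "g = a j \<or> g = inv\<^bsub>A\<^esub> a j" by blast
    then have ji: "j \<noteq> i" using g by (auto simp: c_def c'_def)
    have "f (g \<otimes>\<^bsub>A\<^esub> y) - f (g \<otimes>\<^bsub>A\<^esub> x) \<le> d x y"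
      using lip[of "g \<otimes>\<^bsub>A\<^esub> y" "g \<otimes>\<^bsub>A\<^esub> x"] generator_dist[OF i j(1) ji j(2), of x]
      by (simp add: y_def)
    then have "f (g \<otimes>\<^bsub>A\<^esub> y) - f y \<le> f (g \<otimes>\<^bsub>A\<^esub> x) - f x" using fxy by linarith
    then have "w y (g \<otimes>\<^bsub>A\<^esub> y) / \<mu> y * (f (g \<otimes>\<^bsub>A\<^esub> y) - f y)
        \<le> w y (g \<otimes>\<^bsub>A\<^esub> y) / \<mu> y * (f (g \<otimes>\<^bsub>A\<^esub> x) - f x)"
      by (intro mult_left_mono) (auto simp: less_imp_le)
    then show ?thesis
      unfolding T_def using generator_weight[OF i j(1) ji j(2), of x] by (simp add: y_def)
  next
    case False
    then have "\<not> adj w z (g \<otimes>\<^bsub>A\<^esub> z)" for z unfolding adj_iff_generator by simp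
    then show ?thesis by (simp add: T_def w_eq_0)
  qed
  have split: "laplacian w \<mu> f z = (\<Sum>g\<in>{c, c'}. T z g) + (\<Sum>g\<in>UNIV - {c, c'}. T z g)" for z
    unfolding laplacian_translate T_def[symmetric]
    by (subst sum.subset_diff[of "{c, c'}" UNIV]) (auto simp: add.commute)
  have "(\<Sum>g\<in>UNIV - {c, c'}. T y g) \<le> (\<Sum>g\<in>UNIV - {c, c'}. T x g)"
    by (rule sum_mono) (use rest in auto)
  then show ?thesis using pair split[of x] split[of y] unfolding y_def by linarith
qed

lemma nonneg_curvature: "nonneg_ollivier_curvature w \<mu> d"
proof (rule nonneg_ollivier_curvatureI)
  fix x y f
  assume xy: "adj w x y" and lip: "\<And>z z'. f z' - f z \<le> d z z'" and f: "f y - f x = d x y"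
  then obtain i where i: "i \<in> {1..m}" "y = a i \<otimes>\<^bsub>A\<^esub> x \<or> y = inv\<^bsub>A\<^esub> a i \<otimes>\<^bsub>A\<^esub> x"
    unfolding adj_iff_generator by blast
  from i(2) show "laplacian w \<mu> f y \<le> laplacian w \<mu> f x"
  proof
    assume y: "y = a i \<otimes>\<^bsub>A\<^esub> x"
    show ?thesis using laplacian_le_generator[OF i(1) lip, of x] f unfolding y by blast
  next
    assume "y = inv\<^bsub>A\<^esub> a i \<otimes>\<^bsub>A\<^esub> x"
    then have x: "a i \<otimes>\<^bsub>A\<^esub> y = x" using m_assoc[of "a i" "inv\<^bsub>A\<^esub> a i" x] by simp
    \<comment> \<open>An edge along an inverse generator is read backwards, with -f in place of
      f.\<close>
    have "- f z' - - f z \<le> d z z'" for z z' using lip[of z z'] d_sym[of z z'] by simp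
    from laplacian_le_generator[OF i(1), of "\<lambda>z. - f z", OF this, of y]
    have "laplacian w \<mu> (\<lambda>z. - f z) x \<le> laplacian w \<mu> (\<lambda>z. - f z) y"
      using f d_sym[of x y] unfolding x by simp
    then show ?thesis using laplacian_scale[of "-1" f] by simp
  qed
qed

text \<open>Counting generators and inverses gives only an upper bound, as a generator may be its
  own inverse. The matching lower bound comes from \<open>vertex_degree_ge\<close>.\<close>

lemma max_degree_le: "max_degree w \<le> 2 * m"
proof -
  have "vertex_degree w x \<le> 2 * m" for x
  proof -
    have "{y. adj w y x} \<subseteq> (\<lambda>i. a i \<otimes>\<^bsub>A\<^esub> x) ` {1..m} \<union> (\<lambda>i. inv\<^bsub>A\<^esub> a i \<otimes>\<^bsub>A\<^esub> x) ` {1..m}"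
      using adj_iff_generator adj_sym by fastforce
    then have "vertex_degree w x \<le> card ((\<lambda>i. a i \<otimes>\<^bsub>A\<^esub> x) ` {1..m}
        \<union> (\<lambda>i. inv\<^bsub>A\<^esub> a i \<otimes>\<^bsub>A\<^esub> x) ` {1..m})"
      unfolding vertex_degree_def by (intro card_mono) auto
    also have "\<dots> \<le> card ((\<lambda>i. a i \<otimes>\<^bsub>A\<^esub> x) ` {1..m}) + card ((\<lambda>i. inv\<^bsub>A\<^esub> a i \<otimes>\<^bsub>A\<^esub> x) ` {1..m})"
      by (rule card_Un_le)
    also have "\<dots> \<le> m + m"
      using card_image_le[of "{1..m}" "\<lambda>i. a i \<otimes>\<^bsub>A\<^esub> x"]
        card_image_le[of "{1..m}" "\<lambda>i. inv\<^bsub>A\<^esub> a i \<otimes>\<^bsub>A\<^esub> x"] by simp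
    finally show ?thesis by simp
  qed
  then show ?thesis unfolding max_degree_def by (subst Max_le_iff) auto
qed

end

theorem theorem4p15:
  fixes w :: "'v::finite \<Rightarrow> 'v \<Rightarrow> real" and \<mu> :: "'v \<Rightarrow> real" and d :: "'v \<Rightarrow> 'v \<Rightarrow> real"
    and m :: nat
  assumes "connected_weighted_graph w \<mu>"
    and "general_path_distance w d"
    and "m \<ge> 1"
  shows "(ollivier_betti_sharp w \<mu> d \<and> betti1 w \<mu> d = m) \<longleftrightarrow>
    (\<exists>(A :: 'v monoid) a. weighted_flat_torus A m a w \<mu> d)"
proof
  assume sharp: "ollivier_betti_sharp w \<mu> d \<and> betti1 w \<mu> d = m"
  interpret nonneg_curved_graph w \<mu> d
    by unfold_locales (use assms sharp in \<open>auto simp: ollivier_betti_sharp_def\<close>)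
  have "real (max_degree w) = 2 * real m"
    using sharp by (simp add: ollivier_betti_sharp_def)
  then have "max_degree w = 2 * m" by linarith
  then show "\<exists>(A :: 'v monoid) a. weighted_flat_torus A m a w \<mu> d"
    using weighted_flat_torus_of_max_degree sharp assms(3) by auto
next
  assume "\<exists>(A :: 'v monoid) a. weighted_flat_torus A m a w \<mu> d"
  then obtain A :: "'v monoid" and a where T: "weighted_flat_torus A m a w \<mu> d" by blast
  then have betti: "betti1 w \<mu> d = m" by (simp add: weighted_flat_torus_def Let_def)
  interpret torus_graph w \<mu> d A m a by unfold_locales (use assms T in auto)
  interpret nonneg_curved_graph w \<mu> d by unfold_locales (rule nonneg_curvature)
  \<comment> \<open>The curvature bound just proved makes the general degree bound available, at an
    arbitrary vertex.\<close>
  have "2 * m \<le> vertex_degree w undefined" using vertex_degree_ge betti assms(3) by simp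
  also have "\<dots> \<le> max_degree w" unfolding max_degree_def by (rule Max_ge) auto
  finally have "max_degree w = 2 * m" using max_degree_le by simp
  then show "ollivier_betti_sharp w \<mu> d \<and> betti1 w \<mu> d = m"
    using betti nonneg_curvature by (simp add: ollivier_betti_sharp_def)
qed

end
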